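(* Let $c>0$. Then the set of positive integers $n$ satisfying $$f(n) > \log_3 n - \log(1/c)$$ has asymptotic density $1-e^{-1/c}$. In particular, for any function $\xi:\mathbb{N}\to\mathbb{R}$ with $\xi(n)\to\infty$ as $n\to\infty$, the inequalities $$\log_3 n - \xi(n) \le f(n) \le \log_3 n + \xi(n)$$ hold for almost all integers $n$, i.e. on a set of integers of asymptotic density $1$.
   Context: For a positive integer $n$, let $\omega(n)$ be the number of distinct prime factors of $n$, and let $p_1(n)<p_2(n)<\dots<p_{\omega(n)}(n)$ be the increasing sequence of distinct prime factors of $n$. Define $$f(n) := \max_{1\le j<\omega(n)} \log\!\left(\frac{\log p_{j+1}(n)}{\log p_j(n)}\right)$$ for $n$ with $\omega(n)\ge 2$ (the value assigned when $\omega(n)\le 1$ is immaterial for density statements, since such integers have asymptotic density zero). Here $\log_k$ denotes the $k$-fold iterated natural logarithm, so $\log_3 n=\log\log\log n$ (defined for $n$ sufficiently large). A set $A$ of positive integers has asymptotic density $\delta$ if $|\{n\le x: n\in A\}|/x\to\delta$ as $x\to\infty$. *)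

theory Defs
  imports Complex_Main "HOL-Computational_Algebra.Primes"
begin

definition omega :: "nat \<Rightarrow> nat" where
  "omega n = card (prime_factors n)"

text \<open>The index \<open>j\<close> is 1-based: \<open>nth_prime_factor n 1 < \<dots> < nth_prime_factor n (omega n)\<close> are the
  distinct prime factors of \<open>n\<close>; the value is irrelevant for other \<open>j\<close>.\<close>

definition nth_prime_factor :: "nat \<Rightarrow> nat \<Rightarrow> nat" where
  "nth_prime_factor n j = sorted_list_of_set (prime_factors n) ! (j - 1)"

text \<open>The value \<open>0\<close> for \<open>omega n \<le> 1\<close> is an arbitrary convention.\<close>

definition max_log_gap :: "nat \<Rightarrow> real" where
  "max_log_gap n =
     (if omega n \<ge> 2
      then Max ((\<lambda>j. ln (ln (real (nth_prime_factor n (j + 1))) / ln (real (nth_prime_factor n j))))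
                  ` {1..<omega n})
      else 0)"

text \<open>For the finitely many integers whose \<open>k\<close>-fold logarithm is undefined, the value
  is whatever the total function \<open>ln\<close> yields; this does not affect densities.\<close>

definition iter_ln :: "nat \<Rightarrow> real \<Rightarrow> real" where
  "iter_ln k x = (ln ^^ k) x"

definition has_asymptotic_density :: "nat set \<Rightarrow> real \<Rightarrow> bool" where
  "has_asymptotic_density A \<delta> \<longleftrightarrow>
     ((\<lambda>x::real. real (card {n \<in> A. 1 \<le> n \<and> real n \<le> x}) / x) \<longlongrightarrow> \<delta>) at_top"

end

theory Submission
  imports
    Defs
    "HOL-Number_Theory.Prime_Powers"
    "HOL-Probability.Product_PMF"
    "HOL-Real_Asymp.Real_Asymp"
begin

text \<open>
  Write \<open>T = ln (ln n)\<close>. The inequality says that some prime factor \<open>p\<close> of \<open>n\<close> is followed by no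
  prime factor up to \<open>p ^ (c T)\<close> but by a larger one. If the events \<open>p dvd n\<close> were independent with
  probabilities \<open>1 / p\<close>, such a gap would open at \<open>p\<close> with probability about \<open>1 / (p c T)\<close>
  by Mertens' theorem, and these probabilities sum to \<open>1 / c\<close>. Gaps are almost independent of each
  other: the probability \<open>F p\<close> that none opens up to \<open>p\<close> satisfies a recursion of the shape
  \<open>F p = (1 - 1 / (p c T)) * F (p - 1)\<close> up to small errors, whence the limit \<open>exp (- 1 / c)\<close>.

  The model is compared with the integers up to \<open>N\<close> in total variation by Brun's sieve (Bonferroni's
  inequalities with Rankin's trick), for primes up to \<open>N\<close> to a power of order \<open>1 / T\<^sup>2\<close>. Gaps at
  larger primes are rare, because by Turan's second moment argument few integers avoid all primes in
  \<open>(u, v]\<close> when \<open>ln (ln v) - ln (ln u)\<close> is large.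
\<close>

section \<open>Chebyshev's bound\<close>

definition primes_in :: "nat \<Rightarrow> nat \<Rightarrow> nat set" where
  "primes_in u v = {p. prime p \<and> u < p \<and> p \<le> v}"

lemma finite_primes_in [simp]: "finite (primes_in u v)"
  by (rule finite_subset[of _ "{..v}"]) (auto simp: primes_in_def)

lemma primes_in_self [simp]: "primes_in u u = {}"
  by (auto simp: primes_in_def)

lemma primes_in_ge2: "p \<in> primes_in u v \<Longrightarrow> 2 \<le> p"
  using prime_ge_2_nat by (auto simp: primes_in_def)

lemma primes_in_Suc:
  "u \<le> v \<Longrightarrow> primes_in u (Suc v) =
     (if prime (Suc v) then insert (Suc v) (primes_in u v) else primes_in u v)"
  by (auto simp: primes_in_def le_Suc_eq)

lemma Suc_notin_primes_in [simp]: "Suc v \<notin> primes_in u v"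
  by (simp add: primes_in_def)

lemma primes_in_Un: "u \<le> v \<Longrightarrow> v \<le> w \<Longrightarrow> primes_in u w = primes_in u v \<union> primes_in v w"
  by (auto simp: primes_in_def)

lemma primes_in_disjoint: "primes_in u v \<inter> primes_in v w = {}"
  by (auto simp: primes_in_def)

lemma pairwise_coprime_primes_in: "pairwise coprime (primes_in u v)"
  by (auto simp: pairwise_def primes_in_def intro: primes_coprime)

lemma pairwise_coprime_prod_dvd_iff:
  fixes n :: nat
  assumes "finite A" "pairwise coprime A"
  shows "\<Prod>A dvd n \<longleftrightarrow> (\<forall>a\<in>A. a dvd n)"
proof
  assume "\<forall>a\<in>A. a dvd n"
  with assms show "\<Prod>A dvd n"
  proof (induction A rule: finite_induct)
    case (insert a A)
    then have "coprime a (\<Prod>A)"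
      by (intro prod_coprime_right) (auto simp: pairwise_insert)
    with insert show ?case by (simp add: divides_mult pairwise_insert)
  qed simp
qed (use assms(1) in \<open>auto intro: dvd_trans dvd_prodI[of A _ "\<lambda>a. a"]\<close>)

lemma central_binomial_odd_le: "(2 * m + 1 choose m) \<le> 4 ^ m"
proof -
  have "(2 * m + 1 choose m) \<le> (\<Sum>k\<le>m. (2 * m + 1 choose k))"
    by (rule member_le_sum) auto
  also have "\<dots> = 4 ^ m" by (subst binomial_r_part_sum) (simp add: power_mult)
  finally show ?thesis .
qed

lemma prod_primes_in_dvd_binomial: "\<Prod>(primes_in (m + 1) (2 * m + 1)) dvd (2 * m + 1 choose m)"
  unfolding pairwise_coprime_prod_dvd_iff[OF finite_primes_in pairwise_coprime_primes_in]
proof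
  fix p assume "p \<in> primes_in (m + 1) (2 * m + 1)"
  then have p: "prime p" "m + 1 < p" "p \<le> 2 * m + 1" by (auto simp: primes_in_def)
  have "fact m * fact (m + 1) * (2 * m + 1 choose m) = (fact (2 * m + 1) :: nat)"
    using binomial_fact_lemma[of m "2 * m + 1"] by simp
  moreover have "p dvd (fact (2 * m + 1) :: nat)" using p by (simp only: prime_dvd_fact_iff)
  moreover have "\<not> p dvd (fact m :: nat)" "\<not> p dvd (fact (m + 1) :: nat)"
    using p by (simp_all only: prime_dvd_fact_iff)
  ultimately show "p dvd (2 * m + 1 choose m)" using p(1) by (metis prime_dvd_mult_iff)
qed

lemma primorial_le: "\<Prod>(primes_in 0 n) \<le> 4 ^ n"
proof (induction n rule: less_induct)
  case (less n)
  consider "n \<le> 2" | "2 < n" "even n" | "2 < n" "odd n" by linarith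
  then show ?case
  proof cases
    case 1
    then have "n = 0 \<or> n = 1 \<or> n = 2" by linarith
    then show ?thesis by (auto simp: primes_in_Suc numeral_2_eq_2)
  next
    case 2
    then obtain k where k: "n = Suc k" by (cases n) auto
    have "\<not> prime n" using 2 prime_odd_nat by blast
    then have "primes_in 0 n = primes_in 0 k" by (simp add: k primes_in_Suc)
    with less.IH[of k] show ?thesis by (simp add: k)
  next
    case 3
    then obtain m where m: "n = 2 * m + 1" "0 < m" by (auto elim!: oddE)
    have "\<Prod>(primes_in (m + 1) n) \<le> (2 * m + 1 choose m)"
      using prod_primes_in_dvd_binomial[of m] by (auto intro: dvd_imp_le simp: m)
    also have "\<dots> \<le> 4 ^ m" by (rule central_binomial_odd_le)
    finally have upper: "\<Prod>(primes_in (m + 1) n) \<le> 4 ^ m" .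
    have "\<Prod>(primes_in 0 n) = \<Prod>(primes_in 0 (m + 1)) * \<Prod>(primes_in (m + 1) n)"
      using primes_in_Un[of 0 "m + 1" n] m by (simp add: prod.union_disjoint primes_in_disjoint)
    also have "\<dots> \<le> 4 ^ (m + 1) * 4 ^ m"
      using less.IH[of "m + 1"] m upper by (intro mult_mono) auto
    also have "\<dots> = 4 ^ n" by (simp add: m mult_2 flip: power_add)
    finally show ?thesis .
  qed
qed

lemma sum_ln_primes_le: "(\<Sum>p\<in>primes_in 0 n. ln (real p)) \<le> n * ln 4"
proof -
  have pos: "0 < \<Prod>(primes_in 0 n)" by (rule prod_pos) (auto simp: primes_in_def)
  have "(\<Sum>p\<in>primes_in 0 n. ln (real p)) = ln (real (\<Prod>(primes_in 0 n)))"
    unfolding of_nat_prod by (subst ln_prod) (auto dest: primes_in_ge2)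
  also have "\<dots> \<le> ln (real (4 ^ n))"
    using primorial_le[of n] pos by (intro ln_mono) (simp_all only: of_nat_le_iff of_nat_0_less_iff)
  finally show ?thesis by (simp add: ln_realpow)
qed

section \<open>Mertens' theorems\<close>

lemma real_div_ge: "real n / real d - 1 \<le> real (n div d)"
  using floor_divide_of_nat_eq[of n d, where ?'a = real] by linarith

lemma card_multiples:
  assumes "d > 0"
  shows "card {m\<in>{1..n}. d dvd m} = n div d"
proof -
  have "{m\<in>{1..n}. d dvd m} = (\<lambda>k. d * k) ` {1..n div d}"
    using assms
    by (auto simp: image_iff div_le_mono less_eq_div_iff_mult_less_eq mult.commute elim!: dvdE)
  moreover have "inj_on (\<lambda>k. d * k) {1..n div d}" using assms by (auto simp: inj_on_def)
  ultimately show ?thesis by (simp add: card_image)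
qed

lemma sum_dvd_indicator:
  assumes "d > 0"
  shows "(\<Sum>m=1..n. of_bool (d dvd m) :: real) = real (n div d)"
  using card_multiples[OF assms, of n] by (simp add: sum_of_bool_eq Int_def)

lemma sum_sum_divisors:
  fixes g :: "nat \<Rightarrow> real"
  shows "(\<Sum>m=1..n. \<Sum>d | d dvd m. g d) = (\<Sum>d=1..n. g d * real (n div d))"
proof -
  have "(\<Sum>m=1..n. \<Sum>d | d dvd m. g d) = (\<Sum>m=1..n. \<Sum>d=1..n. g d * of_bool (d dvd m))"
  proof (rule sum.cong[OF refl])
    fix m assume m: "m \<in> {1..n}"
    then have "{d. d dvd m} \<subseteq> {1..n}"
      using dvd_imp_le[of _ m] by (force simp: Suc_le_eq dest: dvd_pos_nat)
    then have "(\<Sum>d | d dvd m. g d * of_bool (d dvd m)) = (\<Sum>d=1..n. g d * of_bool (d dvd m))"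
      by (intro sum.mono_neutral_left) auto
    then show "(\<Sum>d | d dvd m. g d) = (\<Sum>d=1..n. g d * of_bool (d dvd m))" by simp
  qed
  also have "\<dots> = (\<Sum>d=1..n. g d * (\<Sum>m=1..n. of_bool (d dvd m)))"
    unfolding sum_distrib_left by (rule sum.swap)
  also have "\<dots> = (\<Sum>d=1..n. g d * real (n div d))"
    by (intro sum.cong refl arg_cong2[of _ _ _ _ "(*)"] sum_dvd_indicator) simp
  finally show ?thesis .
qed

lemma ln_fact_eq_sum_mangoldt: "ln (fact n) = (\<Sum>d=1..n. mangoldt d * real (n div d))"
proof -
  have "ln (fact n :: real) = (\<Sum>m=1..n. ln (real m))"
    by (induction n) (auto simp: ln_mult)
  also have "\<dots> = (\<Sum>m=1..n. \<Sum>d | d dvd m. mangoldt d)"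
    using mangoldt_sum[where ?'a = real] by (intro sum.cong) auto
  also have "\<dots> = (\<Sum>d=1..n. mangoldt d * real (n div d))" by (rule sum_sum_divisors)
  finally show ?thesis .
qed

lemma ln_fact_le: "ln (fact n :: real) \<le> n * ln n"
proof (cases "n = 0")
  case False
  have "ln (fact n :: real) \<le> ln (real (n ^ n))"
    using fact_le_power[of n] False by (intro ln_mono) auto
  with False show ?thesis by (simp add: ln_realpow)
qed simp

lemma power_div_fact_le_exp:
  assumes "0 \<le> x"
  shows "x ^ n / fact n \<le> exp (x :: real)"
proof -
  have exp_sums: "(\<lambda>k. x ^ k / fact k) sums exp x"
    using exp_converges[of x] by (simp add: field_simps)
  have "(\<Sum>k\<in>{n}. x ^ k / fact k) \<le> (\<Sum>k. x ^ k / fact k)"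
    using assms by (intro sum_le_suminf sums_summable[OF exp_sums]) auto
  with exp_sums show ?thesis by (simp add: sums_iff)
qed

lemma ln_fact_ge: "n * ln n - n \<le> ln (fact n :: real)"
proof (cases "n = 0")
  case False
  then have "ln (real n ^ n / fact n) \<le> n"
    using power_div_fact_le_exp[of "real n" n] ln_mono[of "real n ^ n / fact n" "exp (real n)"]
    by simp
  with False show ?thesis by (simp add: ln_div ln_realpow)
qed simp

definition prime_log_sum :: "nat \<Rightarrow> real" where
  "prime_log_sum n = (\<Sum>p\<in>primes_in 0 n. ln p / p)"

lemma prime_log_sum_le:
  assumes "n > 0"
  shows "prime_log_sum n \<le> ln n + ln 4"
proof -
  have "n * prime_log_sum n - n * ln 4 \<le> n * prime_log_sum n - (\<Sum>p\<in>primes_in 0 n. ln (real p))"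
    using sum_ln_primes_le[of n] by simp
  also have "\<dots> = (\<Sum>p\<in>primes_in 0 n. ln (real p) * (n / p - 1))"
    by (simp add: prime_log_sum_def sum_distrib_left sum_subtractf algebra_simps)
  also have "\<dots> \<le> (\<Sum>p\<in>primes_in 0 n. ln (real p) * real (n div p))"
    by (intro sum_mono mult_left_mono real_div_ge) (auto dest: primes_in_ge2)
  also have "\<dots> = (\<Sum>d\<in>primes_in 0 n. mangoldt d * real (n div d))"
    by (intro sum.cong) (auto simp: primes_in_def)
  also have "\<dots> \<le> (\<Sum>d=1..n. mangoldt d * real (n div d))"
    by (rule sum_mono2) (auto simp: primes_in_def mangoldt_nonneg)
  also have "\<dots> = ln (fact n)" by (simp add: ln_fact_eq_sum_mangoldt)
  also have "\<dots> \<le> n * ln n" by (rule ln_fact_le)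
  finally have "n * prime_log_sum n \<le> n * (ln n + ln 4)" by (simp add: algebra_simps)
  with assms show ?thesis by simp
qed

lemma primepow_le_subset:
  "{d\<in>{1..n}. primepow d} \<subseteq> (\<lambda>(p, k). p ^ k) ` (primes_in 0 n \<times> {1..n})"
proof
  fix d assume d: "d \<in> {d\<in>{1..n}. primepow d}"
  then obtain p k where pk: "prime p" "k > 0" "d = p ^ k" by (auto simp: primepow_def)
  have "k < p ^ k" using power_gt_expt[of p k] prime_gt_1_nat[OF pk(1)] by simp
  moreover have "p \<le> p ^ k" using pk by (simp add: prime_gt_0_nat self_le_power Suc_leI)
  ultimately have "(p, k) \<in> primes_in 0 n \<times> {1..n}"
    using d pk by (auto simp: primes_in_def prime_gt_0_nat)
  with pk(3) show "d \<in> (\<lambda>(p, k). p ^ k) ` (primes_in 0 n \<times> {1..n})"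
    by (intro image_eqI[of _ _ "(p, k)"]) auto
qed

lemma sum_inverse_powers_le:
  assumes "x > (1 :: real)"
  shows "(\<Sum>k=1..n. 1 / x ^ k) \<le> 1 / (x - 1)"
proof -
  have "(\<Sum>k=1..n. 1 / x ^ k) = 1 / x * (\<Sum>k<n. (1 / x) ^ k)"
    by (simp add: sum.atLeast1_atMost_eq sum_distrib_left power_one_over)
  also have "\<dots> \<le> 1 / x * (1 / (1 - 1 / x))"
    using assms geometric_sum_less[of "1 / x" "{..<n}"] by (intro mult_left_mono) auto
  also have "\<dots> = 1 / (x - 1)" using assms by (simp add: field_simps)
  finally show ?thesis .
qed

lemma sum_mangoldt_div_le:
  "(\<Sum>d=1..n. mangoldt d / real d) \<le> (\<Sum>p\<in>primes_in 0 n. ln p / (real p - 1))"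
proof -
  let ?pow = "\<lambda>(p, k). p ^ k :: nat" and ?I = "primes_in 0 n \<times> {1..n}"
  have "(\<Sum>d=1..n. mangoldt d / real d) = (\<Sum>d\<in>{d\<in>{1..n}. primepow d}. mangoldt d / real d)"
    by (rule sum.mono_neutral_right) (auto simp: mangoldt_def)
  also have "\<dots> \<le> (\<Sum>d\<in>?pow ` ?I. mangoldt d / real d)"
    by (rule sum_mono2) (use primepow_le_subset in \<open>auto simp: mangoldt_nonneg\<close>)
  also have "\<dots> \<le> (\<Sum>x\<in>?I. mangoldt (?pow x) / real (?pow x))"
    by (rule sum_image_le[of _ "\<lambda>d. mangoldt d / real d", unfolded o_def])
       (auto simp: mangoldt_nonneg)
  also have "\<dots> = (\<Sum>p\<in>primes_in 0 n. \<Sum>k=1..n. ln p / real p ^ k)"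
    by (subst sum.cartesian_product) (auto intro!: sum.cong simp: primes_in_def)
  also have "\<dots> = (\<Sum>p\<in>primes_in 0 n. ln p * (\<Sum>k=1..n. 1 / real p ^ k))"
    by (simp add: sum_distrib_left)
  also have "\<dots> \<le> (\<Sum>p\<in>primes_in 0 n. ln p * (1 / (real p - 1)))"
    by (intro sum_mono mult_left_mono sum_inverse_powers_le) (auto dest: primes_in_ge2)
  finally show ?thesis by simp
qed

lemma ln_div_mult_pred_le:
  assumes "m \<ge> (2::nat)"
  shows "ln m / (m * (real m - 1)) \<le> 4 * (1 / sqrt (real m - 1) - 1 / sqrt m)"
proof -
  define s t where "s = sqrt m" and "t = sqrt (real m - 1)"
  have m: "real m = s\<^sup>2" "real m - 1 = t\<^sup>2" using assms by (auto simp: s_def t_def)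
  have st: "1 \<le> t" "t < s" using assms by (auto simp: s_def t_def)
  have s2: "s\<^sup>2 = t\<^sup>2 + 1" using m by simp
  also have "\<dots> \<le> (t + 1)\<^sup>2" using st by (simp add: power2_sum)
  finally have "s \<le> t + 1" using st by (intro power2_le_imp_le[of s "t + 1"]) auto
  moreover have "ln (real m) = 2 * ln s" using st by (simp add: m ln_realpow)
  ultimately have "ln (real m) \<le> 2 * t" using ln_le_minus_one[of s] st by simp
  then have "ln (real m) / (m * (real m - 1)) \<le> 2 * t / (s\<^sup>2 * t\<^sup>2)"
    unfolding m(2) using st by (simp add: m divide_right_mono)
  also have "\<dots> = 4 * (1 / (2 * s)) / (s * t)" using st by (simp add: field_simps power2_eq_square)
  also have "\<dots> \<le> 4 * (1 / (s + t)) / (s * t)"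
    using st by (intro divide_right_mono mult_left_mono divide_left_mono) auto
  also have "1 / (s + t) = s - t" using s2 st by (simp add: field_simps power2_eq_square)
  also have "4 * (s - t) / (s * t) = 4 * (1 / t - 1 / s)" using st by (simp add: field_simps)
  finally show ?thesis by (simp add: s_def t_def)
qed

lemma prime_log_tail_le: "(\<Sum>p\<in>primes_in 0 n. ln p / (p * (real p - 1))) \<le> 4"
proof -
  define f where "f m = 1 / sqrt (real m)" for m
  have f_antimono: "f (Suc m) \<le> f m" if "m > 0" for m
    using that by (simp add: f_def frac_le)
  have "(\<Sum>p\<in>primes_in 0 n. ln p / (p * (real p - 1))) \<le> (\<Sum>p\<in>primes_in 0 n. 4 * (f (p - 1) - f p))"
    using ln_div_mult_pred_le
    by (intro sum_mono) (auto dest!: primes_in_ge2 simp: f_def of_nat_diff)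
  also have "\<dots> \<le> (\<Sum>p=Suc 1..Suc n. 4 * (f (p - 1) - f p))"
    using f_antimono[of "p - 1" for p]
    by (intro sum_mono2) (auto simp: primes_in_def dest: prime_ge_2_nat)
  also have "\<dots> = 4 * (\<Sum>p=Suc 1..Suc n. - f p - - f (p - 1))"
    by (simp add: sum_distrib_left)
  also have "\<dots> = 4 * (f 1 - f (Suc n))" by (subst sum_telescope'') auto
  also have "\<dots> \<le> 4" by (simp add: f_def)
  finally show ?thesis .
qed

lemma prime_log_sum_ge:
  assumes "n > 0"
  shows "ln n - 5 \<le> prime_log_sum n"
proof -
  have "n * ln n - n \<le> (\<Sum>d=1..n. mangoldt d * real (n div d))"
    using ln_fact_ge[of n] by (simp add: ln_fact_eq_sum_mangoldt)
  also have "\<dots> \<le> (\<Sum>d=1..n. mangoldt d * (real n / real d))"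
    by (intro sum_mono mult_left_mono of_nat_div_le_of_nat mangoldt_nonneg)
  also have "\<dots> = n * (\<Sum>d=1..n. mangoldt d / real d)"
    by (simp add: sum_distrib_left field_simps)
  also have "\<dots> \<le> n * (\<Sum>p\<in>primes_in 0 n. ln p / (real p - 1))"
    by (intro mult_left_mono sum_mangoldt_div_le) auto
  finally have "real n * (ln n - 1) \<le> n * (\<Sum>p\<in>primes_in 0 n. ln p / (real p - 1))"
    by (simp add: algebra_simps)
  then have "ln n - 1 \<le> (\<Sum>p\<in>primes_in 0 n. ln p / (real p - 1))" using assms by simp
  also have "\<dots> = (\<Sum>p\<in>primes_in 0 n. ln p / p + ln p / (p * (real p - 1)))"
    by (intro sum.cong refl, drule primes_in_ge2) (simp add: field_simps)
  also have "\<dots> \<le> prime_log_sum n + 4"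
    using prime_log_tail_le[of n] by (simp add: prime_log_sum_def sum.distrib)
  finally show ?thesis by simp
qed

lemma abs_prime_log_sum_diff_ln_le:
  assumes "n > 0"
  shows "\<bar>prime_log_sum n - ln n\<bar> \<le> 5"
  using prime_log_sum_le[OF assms] prime_log_sum_ge[OF assms] ln_le_minus_one[of "4::real"]
  by linarith

lemma abs_ln_increment_le:
  assumes "0 < a" "a \<le> b" "b \<le> a + (1::real)"
  shows "\<bar>(b - a) / b - (ln b - ln a)\<bar> \<le> 1 / a - 1 / b"
proof -
  have "(b - a) / b \<le> ln b - ln a"
    using ln_diff_le[of a b] assms by (simp add: field_simps)
  moreover have "ln b - ln a \<le> (b - a) / a"
    using assms by (intro ln_diff_le) auto
  moreover have "(b - a) * (1 / a - 1 / b) \<le> 1 * (1 / a - 1 / b)"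
    using assms by (intro mult_right_mono) (auto simp: frac_le)
  ultimately show ?thesis by (simp add: algebra_simps abs_le_iff)
qed

text \<open>Partial summation with the weight \<open>1 / ln\<close>, in incremental form: the boundary term
  \<open>R v / ln v\<close>, where \<open>R v = A v - ln v\<close>, is carried along.\<close>

lemma abs_sum_increments_div_ln_le:
  fixes A :: "nat \<Rightarrow> real"
  assumes bound: "\<And>n. n \<ge> u \<Longrightarrow> \<bar>A n - ln n\<bar> \<le> C" and "2 \<le> u" "u \<le> v"
  shows "\<bar>(\<Sum>n=u..<v. (A (Suc n) - A n) / ln (Suc n)) - (ln (ln v) - ln (ln u))\<bar>
      \<le> (2 * C + 1) / ln u"
proof -
  define R where "R n = A n - ln (real n)" for n
  define E where "E v = (\<Sum>n=u..<v. (A (Suc n) - A n) / ln (Suc n)) - (ln (ln v) - ln (ln u))" for v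
  have "\<bar>E v - R v / ln v + R u / ln u\<bar> \<le> (C + 1) * (1 / ln u - 1 / ln v)"
    using assms(3)
  proof (induction v rule: dec_induct)
    case (step n)
    define a b where "a = ln (real n)" and "b = ln (real (Suc n))"
    have ab: "0 < a" "a < b" using step.hyps assms(2) by (auto simp: a_def b_def)
    have "b - a \<le> 1"
      using ln_diff_le[of "real (Suc n)" "real n"] step.hyps assms(2)
      by (simp add: a_def b_def order_trans[of _ "1 / real n"])
    then have ln_incr: "\<bar>(b - a) / b - (ln b - ln a)\<bar> \<le> 1 / a - 1 / b"
      using ab by (intro abs_ln_increment_le) auto
    have "\<bar>R n * (1 / a - 1 / b)\<bar> \<le> C * (1 / a - 1 / b)"
      unfolding abs_mult using bound[of n] step.hyps ab
      by (intro mult_mono) (auto simp: R_def frac_le)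
    moreover have "(E (Suc n) - R (Suc n) / b) - (E n - R n / a)
        = ((b - a) / b - (ln b - ln a)) + R n * (1 / a - 1 / b)"
      using step.hyps
      by (simp add: E_def R_def a_def b_def diff_divide_distrib add_divide_distrib algebra_simps)
    ultimately have "\<bar>(E (Suc n) - R (Suc n) / b) - (E n - R n / a)\<bar> \<le> (C + 1) * (1 / a - 1 / b)"
      using ln_incr by (simp add: distrib_right)
    then show ?case using step.IH unfolding a_def[symmetric] b_def[symmetric] by argo
  qed (simp add: E_def)
  moreover have "\<bar>R v / ln v\<bar> \<le> C * (1 / ln v)" "\<bar>R u / ln u\<bar> \<le> C * (1 / ln u)"
    using bound[of v] bound[of u] assms by (simp_all add: R_def abs_divide divide_right_mono)
  moreover have "1 / ln v \<ge> 0" using assms by simp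
  ultimately have "\<bar>E v\<bar> \<le> (2 * C + 1) * (1 / ln u)" by argo
  then show ?thesis by (simp add: E_def)
qed

lemma ln_log_eq:
  assumes "2 \<le> u" "2 \<le> v"
  shows "ln (log (real u) (real v)) = ln (ln v) - ln (ln u)"
  using assms by (simp add: log_def ln_div)

definition recip_sum :: "nat set \<Rightarrow> real" where
  "recip_sum A = (\<Sum>a\<in>A. 1 / a)"

abbreviation prime_recip_sum :: "nat \<Rightarrow> nat \<Rightarrow> real" where
  "prime_recip_sum u v \<equiv> recip_sum (primes_in u v)"

lemma recip_sum_nonneg: "0 \<le> recip_sum A"
  by (simp add: recip_sum_def sum_nonneg)

lemma prime_recip_sum_eq_sum_increments:
  assumes "u \<le> v"
  shows "prime_recip_sum u v = (\<Sum>n=u..<v. (prime_log_sum (Suc n) - prime_log_sum n) / ln (Suc n))"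
  using assms
proof (induction v rule: dec_induct)
  case (step n)
  then show ?case
    by (cases "n = 0") (auto simp: recip_sum_def prime_log_sum_def primes_in_Suc)
qed (simp add: recip_sum_def)

theorem mertens_second:
  assumes "2 \<le> u" "u \<le> v"
  shows "\<bar>prime_recip_sum u v - ln (log u v)\<bar> \<le> 11 / ln u"
  using abs_sum_increments_div_ln_le[of u prime_log_sum 5 v] abs_prime_log_sum_diff_ln_le assms
  by (simp add: prime_recip_sum_eq_sum_increments ln_log_eq)

lemma prod_one_minus_le_exp:
  fixes x :: "'a \<Rightarrow> real"
  assumes "finite A" "\<And>a. a \<in> A \<Longrightarrow> x a \<le> 1"
  shows "(\<Prod>a\<in>A. 1 - x a) \<le> exp (- sum x A)"
proof -
  have "(\<Prod>a\<in>A. 1 - x a) \<le> (\<Prod>a\<in>A. exp (- x a))"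
    using exp_ge_add_one_self[of "- x a" for a] assms by (intro prod_mono) auto
  with assms show ?thesis by (simp add: exp_sum flip: sum_negf)
qed

lemma prod_one_minus_ge_exp:
  fixes x :: "'a \<Rightarrow> real"
  assumes "finite A" "\<And>a. a \<in> A \<Longrightarrow> 0 \<le> x a \<and> x a < 1"
  shows "exp (- (\<Sum>a\<in>A. x a / (1 - x a))) \<le> (\<Prod>a\<in>A. 1 - x a)"
proof -
  have "exp (- (x a / (1 - x a))) \<le> 1 - x a" if "a \<in> A" for a
  proof -
    have "1 / (1 - x a) \<le> exp (x a / (1 - x a))"
      using exp_ge_add_one_self[of "x a / (1 - x a)"] assms(2)[OF that] by (simp add: field_simps)
    then show ?thesis using assms(2)[OF that] by (simp add: exp_minus field_simps)
  qed
  then have "(\<Prod>a\<in>A. exp (- (x a / (1 - x a)))) \<le> (\<Prod>a\<in>A. 1 - x a)"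
    by (intro prod_mono) auto
  with assms(1) show ?thesis by (simp add: exp_sum flip: sum_negf)
qed

lemma sum_inverse_mult_pred_le:
  assumes "u > 0"
  shows "(\<Sum>q\<in>primes_in u v. 1 / (real q * (real q - 1))) \<le> 1 / real u"
proof (cases "u \<le> v")
  case True
  have "(\<Sum>q\<in>primes_in u v. 1 / (real q * (real q - 1)))
      \<le> (\<Sum>q=Suc u..v. 1 / (real q * (real q - 1)))"
    using assms by (intro sum_mono2) (auto simp: primes_in_def)
  also have "\<dots> = (\<Sum>q=Suc u..v. - (1 / real q) - - (1 / real (q - 1)))"
    using assms by (intro sum.cong) (auto simp: field_simps of_nat_diff)
  also have "\<dots> = 1 / real u - 1 / real v"
    by (subst sum_telescope''[OF True]) simp
  also have "\<dots> \<le> 1 / real u" by simp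
  finally show ?thesis .
next
  case False
  then have "primes_in u v = {}" by (auto simp: primes_in_def)
  then show ?thesis by simp
qed

definition euler_prod :: "nat \<Rightarrow> nat \<Rightarrow> real" where
  "euler_prod u v = (\<Prod>p\<in>primes_in u v. 1 - 1 / p)"

text \<open>Here \<open>11 / ln u\<close> comes from Mertens' second theorem and \<open>1 / u \<le> 1 / ln u\<close> from comparing
  \<open>1 - 1 / p\<close> with \<open>exp (- 1 / p)\<close>.\<close>

definition mertens_error :: "nat \<Rightarrow> real" where
  "mertens_error u = 12 / ln u"

lemma mertens_error_nonneg: "0 \<le> mertens_error u"
  by (cases "u = 0") (auto simp: mertens_error_def)

lemma mertens_error_antimono: "2 \<le> u \<Longrightarrow> u \<le> v \<Longrightarrow> mertens_error v \<le> mertens_error u"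
  by (auto simp: mertens_error_def intro!: divide_left_mono)

lemma mertens_error_tendsto_0: "mertens_error \<longlonglongrightarrow> 0"
  unfolding mertens_error_def by real_asymp

lemma abs_prime_recip_sum_diff_le:
  assumes "2 \<le> u" "u \<le> v"
  shows "\<bar>prime_recip_sum u v - ln (log u v)\<bar> \<le> mertens_error u"
proof -
  have "11 / ln u \<le> mertens_error u"
    unfolding mertens_error_def using assms by (intro divide_right_mono) auto
  with mertens_second[OF assms] show ?thesis by linarith
qed

lemma log_ge_1: "2 \<le> u \<Longrightarrow> u \<le> v \<Longrightarrow> 1 \<le> log (real u) (real v)"
  by (subst one_le_log_cancel_iff) auto

theorem mertens_third:
  assumes "2 \<le> u" "u \<le> v"
  shows "exp (- mertens_error u) / log u v \<le> euler_prod u v"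
    and "euler_prod u v \<le> exp (mertens_error u) / log u v"
proof -
  have log_pos: "0 < log u v" using log_ge_1[OF assms] by simp
  have recip: "ln (log u v) - 11 / ln u \<le> prime_recip_sum u v"
      "prime_recip_sum u v \<le> ln (log u v) + 11 / ln u"
    using mertens_second[OF assms] by linarith+
  have "euler_prod u v \<le> exp (- prime_recip_sum u v)"
    unfolding euler_prod_def recip_sum_def
    by (rule prod_one_minus_le_exp) (auto dest: primes_in_ge2)
  also have "\<dots> \<le> exp (mertens_error u - ln (log u v))"
    using abs_prime_recip_sum_diff_le[OF assms] by simp
  finally show "euler_prod u v \<le> exp (mertens_error u) / log u v"
    using log_pos by (simp add: exp_diff)
  have "(\<Sum>p\<in>primes_in u v. 1 / real p / (1 - 1 / real p))
      = (\<Sum>p\<in>primes_in u v. 1 / real p + 1 / (real p * (real p - 1)))"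
    by (intro sum.cong refl, drule primes_in_ge2) (simp add: field_simps)
  also have "\<dots> \<le> prime_recip_sum u v + 1 / u"
    using sum_inverse_mult_pred_le[of u v] assms by (simp add: sum.distrib recip_sum_def)
  also have "\<dots> \<le> prime_recip_sum u v + 1 / ln u"
    using ln_le_minus_one[of "real u"] assms by (intro add_left_mono divide_left_mono) auto
  also have "\<dots> \<le> ln (log u v) + mertens_error u"
    using recip by (simp add: mertens_error_def)
  finally have "exp (- mertens_error u - ln (log u v))
      \<le> exp (- (\<Sum>p\<in>primes_in u v. 1 / real p / (1 - 1 / real p)))"
    by simp
  also have "\<dots> \<le> euler_prod u v"
    unfolding euler_prod_def by (rule prod_one_minus_ge_exp) (auto dest: primes_in_ge2)
  finally show "exp (- mertens_error u) / log u v \<le> euler_prod u v"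
    using log_pos by (simp add: exp_diff)
qed

lemma weighted_Cesaro:
  fixes b x :: "nat \<Rightarrow> real"
  assumes b: "\<And>i. 0 \<le> b i" and div: "filterlim (\<lambda>m. \<Sum>i\<le>m. b i) at_top sequentially" and x: "x \<longlonglongrightarrow> l"
  shows "(\<lambda>m. (\<Sum>i\<le>m. b i * x i) / (\<Sum>i\<le>m. b i)) \<longlonglongrightarrow> l"
proof (rule LIMSEQ_I)
  fix e :: real assume "0 < e"
  then obtain n where n: "\<And>i. i \<ge> n \<Longrightarrow> \<bar>x i - l\<bar> < e / 2"
    using LIMSEQ_D[OF x, of "e / 2"] by auto
  define C where "C = (\<Sum>i<n. b i * \<bar>x i - l\<bar>)"
  have "eventually (\<lambda>m. (\<Sum>i\<le>m. b i) > 2 * \<bar>C\<bar> / e) sequentially"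
    using div by (simp add: filterlim_at_top_dense)
  with eventually_ge_at_top[of n]
  have "eventually (\<lambda>m. norm ((\<Sum>i\<le>m. b i * x i) / (\<Sum>i\<le>m. b i) - l) < e) sequentially"
  proof eventually_elim
    case (elim m)
    let ?B = "\<Sum>i\<le>m. b i"
    have "0 \<le> 2 * \<bar>C\<bar> / e" using \<open>0 < e\<close> by simp
    then have B: "0 < ?B" using elim(2) by linarith
    have "C < e / 2 * ?B" using elim(2) \<open>0 < e\<close> by (simp add: field_simps)
    have split: "{..m} = {..<n} \<union> {n..m}" using elim(1) by auto
    have "\<bar>\<Sum>i\<le>m. b i * (x i - l)\<bar> \<le> (\<Sum>i\<le>m. b i * \<bar>x i - l\<bar>)"
      using b by (intro order_trans[OF sum_abs] sum_mono) (simp add: abs_mult)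
    also have "\<dots> = C + (\<Sum>i=n..m. b i * \<bar>x i - l\<bar>)"
      unfolding split C_def by (rule sum.union_disjoint) auto
    also have "\<dots> \<le> C + (\<Sum>i=n..m. b i * (e / 2))"
      using b n by (intro add_left_mono sum_mono mult_left_mono) (auto intro: less_imp_le)
    also have "\<dots> \<le> C + ?B * (e / 2)"
      unfolding sum_distrib_right using b \<open>0 < e\<close> by (intro add_left_mono sum_mono2) auto
    also have "\<dots> < e * ?B" using \<open>C < e / 2 * ?B\<close> by (simp add: field_simps)
    finally have "\<bar>\<Sum>i\<le>m. b i * (x i - l)\<bar> / ?B < e" using B by (simp add: divide_less_eq)
    moreover have "(\<Sum>i\<le>m. b i * x i) / ?B - l = (\<Sum>i\<le>m. b i * (x i - l)) / ?B"
      using B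
      by (simp add: right_diff_distrib sum_subtractf diff_divide_distrib flip: sum_distrib_right)
    ultimately show ?case using B by (simp add: abs_divide)
  qed
  then show "\<exists>N. \<forall>m\<ge>N. norm ((\<Sum>i\<le>m. b i * x i) / (\<Sum>i\<le>m. b i) - l) < e"
    by (simp add: eventually_sequentially)
qed

definition mertens_const :: real where
  "mertens_const = 1 - ln (ln 2) + mertens_error 2"

lemma abs_prime_recip_sum_0_diff_le:
  assumes "2 \<le> y"
  shows "\<bar>prime_recip_sum 0 y - ln (ln y)\<bar> \<le> mertens_const"
proof -
  have "primes_in 0 y = insert 2 (primes_in 2 y)"
    using assms by (auto simp: primes_in_def dest: prime_ge_2_nat)
  then have "prime_recip_sum 0 y = 1 / 2 + prime_recip_sum 2 y"
    by (simp add: recip_sum_def primes_in_def)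
  moreover have "\<bar>prime_recip_sum 2 y - (ln (ln y) - ln (ln 2))\<bar> \<le> mertens_error 2"
    using abs_prime_recip_sum_diff_le[of 2 y] ln_log_eq[of 2 y] assms by simp
  moreover have "ln (ln 2) < (0 :: real)" using ln_2_less_1 by simp
  ultimately show ?thesis unfolding mertens_const_def by linarith
qed

lemma eventually_ln_ln_pos: "eventually (\<lambda>n::nat. ln (ln n) > 0) sequentially"
  by real_asymp

lemma prime_recip_sum_asymp: "(\<lambda>m. prime_recip_sum 0 m / ln (ln m)) \<longlonglongrightarrow> 1"
proof (rule Lim_transform)
  show "(\<lambda>m. prime_recip_sum 0 m / ln (ln m) - 1) \<longlonglongrightarrow> 0"
  proof (rule Lim_null_comparison)
    show "(\<lambda>m. mertens_const / ln (ln (real m))) \<longlonglongrightarrow> 0" by real_asymp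
    show "eventually (\<lambda>m. norm (prime_recip_sum 0 m / ln (ln m) - 1)
        \<le> mertens_const / ln (ln m)) sequentially"
      using eventually_ge_at_top[of 2] eventually_ln_ln_pos
    proof eventually_elim
      case (elim m)
      then have "prime_recip_sum 0 m / ln (ln m) - 1
          = (prime_recip_sum 0 m - ln (ln m)) / ln (ln m)"
        by (simp add: diff_divide_distrib)
      with elim abs_prime_recip_sum_0_diff_le[of m] show ?case
        by (simp add: abs_divide divide_right_mono)
    qed
  qed
qed simp

lemma weighted_prime_recip_sum_asymp:
  assumes "x \<longlonglongrightarrow> (1 :: real)"
  shows "(\<lambda>m. (\<Sum>p\<in>primes_in 0 m. x p / p) / ln (ln m)) \<longlonglongrightarrow> 1"
proof -
  define b where "b p = (if prime p then 1 / real p else 0)" for p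
  have sum_b: "(\<Sum>p\<le>m. b p * f p) = (\<Sum>p\<in>primes_in 0 m. f p / p)" for f m
    by (rule sum.mono_neutral_cong_right) (auto simp: b_def primes_in_def prime_gt_0_nat)
  have recip: "(\<Sum>p\<le>m. b p) = prime_recip_sum 0 m" for m
    using sum_b[of "\<lambda>_. 1" m] by (simp add: recip_sum_def)
  have recip_top: "filterlim (\<lambda>m. \<Sum>p\<le>m. b p) at_top sequentially"
    unfolding recip
  proof (rule filterlim_at_top_mono)
    show "filterlim (\<lambda>m. ln (ln (real m)) - mertens_const) at_top sequentially" by real_asymp
    show "eventually (\<lambda>m. ln (ln (real m)) - mertens_const \<le> prime_recip_sum 0 m) sequentially"
      using eventually_ge_at_top[of 2]
    proof eventually_elim
      case (elim m)
      then show ?case using abs_prime_recip_sum_0_diff_le[of m] by linarith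
    qed
  qed
  have "(\<lambda>m. (\<Sum>p\<le>m. b p * x p) / (\<Sum>p\<le>m. b p) * (prime_recip_sum 0 m / ln (ln m))) \<longlonglongrightarrow> 1 * 1"
    using recip_top assms
    by (intro tendsto_mult weighted_Cesaro prime_recip_sum_asymp) (auto simp: b_def)
  moreover have "eventually (\<lambda>m. (\<Sum>p\<le>m. b p * x p) / (\<Sum>p\<le>m. b p) * (prime_recip_sum 0 m / ln (ln m))
      = (\<Sum>p\<in>primes_in 0 m. x p / p) / ln (ln m)) sequentially"
    using recip_top[unfolded filterlim_at_top_dense, rule_format, of 0]
    by eventually_elim (simp add: sum_b recip)
  ultimately show ?thesis by (simp add: Lim_transform_eventually)
qed

section \<open>Random subsets\<close>

definition random_subset :: "('a \<Rightarrow> real) \<Rightarrow> 'a set \<Rightarrow> 'a set pmf" where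
  "random_subset w P = map_pmf Collect (Pi_pmf P False (\<lambda>x. bernoulli_pmf (w x)))"

lemma set_random_subset:
  assumes "finite P" "S \<in> set_pmf (random_subset w P)"
  shows "S \<subseteq> P"
  using assms set_Pi_pmf_subset[OF assms(1), of False] by (fastforce simp: random_subset_def)

lemma prob_random_subset_cong:
  assumes "finite P" "\<And>S. S \<subseteq> P \<Longrightarrow> E S \<longleftrightarrow> G S"
  shows "measure_pmf.prob (random_subset w P) {S. E S}
      = measure_pmf.prob (random_subset w P) {S. G S}"
  using assms(2)
  by (intro measure_prob_cong_0) (auto simp: pmf_eq_0_set_pmf dest: set_random_subset[OF assms(1)])

lemma pmf_random_subset:
  assumes "finite P" "S \<subseteq> P" "\<And>x. x \<in> P \<Longrightarrow> 0 \<le> w x \<and> w x \<le> 1"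
  shows "pmf (random_subset w P) S = prod w S * (\<Prod>x\<in>P - S. 1 - w x)"
proof -
  have "inj Collect" by (intro injI) (rule Collect_inj)
  from pmf_map_inj'[OF this, of _ "\<lambda>x. x \<in> S"]
  have "pmf (random_subset w P) S = pmf (Pi_pmf P False (\<lambda>x. bernoulli_pmf (w x))) (\<lambda>x. x \<in> S)"
    by (simp add: random_subset_def)
  also have "\<dots> = (\<Prod>x\<in>P. if x \<in> S then w x else 1 - w x)"
    using assms by (subst pmf_Pi') (auto intro!: prod.cong)
  also have "\<dots> = prod w S * (\<Prod>x\<in>P - S. 1 - w x)"
    using assms by (subst prod.If_cases) (auto simp: Int_absorb1 Diff_eq)
  finally show ?thesis .
qed

lemma random_subset_split:
  assumes "finite P"
  shows "map_pmf (\<lambda>S. (S \<inter> A, S - A)) (random_subset w P)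
           = pair_pmf (random_subset w (P \<inter> A)) (random_subset w (P - A))"
proof -
  let ?Pi = "\<lambda>Q. Pi_pmf Q False (\<lambda>x. bernoulli_pmf (w x))"
  let ?join = "\<lambda>(f, g) x. if x \<in> P \<inter> A then f x else g x"
  have "?Pi P = map_pmf ?join (pair_pmf (?Pi (P \<inter> A)) (?Pi (P - A)))"
    using Pi_pmf_union[of "P \<inter> A" "P - A" False] assms by (simp add: Int_Diff_Un Int_Diff_disjoint)
  then have "map_pmf (\<lambda>S. (S \<inter> A, S - A)) (random_subset w P)
      = map_pmf (\<lambda>h. (Collect (?join h) \<inter> A, Collect (?join h) - A))
          (pair_pmf (?Pi (P \<inter> A)) (?Pi (P - A)))"
    by (simp add: random_subset_def pmf.map_comp o_def)
  also have "\<dots> = map_pmf (\<lambda>(f, g). (Collect f, Collect g)) (pair_pmf (?Pi (P \<inter> A)) (?Pi (P - A)))"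
  proof (rule map_pmf_cong[OF refl])
    fix h assume "h \<in> set_pmf (pair_pmf (?Pi (P \<inter> A)) (?Pi (P - A)))"
    then obtain f g where h: "h = (f, g)" "f \<in> set_pmf (?Pi (P \<inter> A))" "g \<in> set_pmf (?Pi (P - A))"
      by auto
    then have "x \<in> P \<inter> A" if "f x" for x
      using set_Pi_pmf_subset[of "P \<inter> A" False] assms that by blast
    moreover have "x \<in> P - A" if "g x" for x
      using set_Pi_pmf_subset[of "P - A" False] assms h(3) that by blast
    ultimately show "(Collect (?join h) \<inter> A, Collect (?join h) - A)
        = (case h of (f, g) \<Rightarrow> (Collect f, Collect g))"
      by (auto simp: h(1))
  qed
  also have "\<dots> = pair_pmf (random_subset w (P \<inter> A)) (random_subset w (P - A))"
    by (simp add: random_subset_def map_pair)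
  finally show ?thesis .
qed

lemma random_subset_Int:
  assumes "finite P"
  shows "map_pmf (\<lambda>S. S \<inter> A) (random_subset w P) = random_subset w (P \<inter> A)"
  using arg_cong[OF random_subset_split[OF assms, of A w], of "map_pmf fst"]
  by (simp add: pmf.map_comp o_def map_fst_pair_pmf)

lemma random_subset_Diff:
  assumes "finite P"
  shows "map_pmf (\<lambda>S. S - A) (random_subset w P) = random_subset w (P - A)"
  using arg_cong[OF random_subset_split[OF assms, of A w], of "map_pmf snd"]
  by (simp add: pmf.map_comp o_def map_snd_pair_pmf)

lemma prob_random_subset_indep:
  assumes P: "finite P"
    and E: "\<And>S. S \<subseteq> P \<Longrightarrow> E S \<longleftrightarrow> E (S \<inter> A)" and G: "\<And>S. S \<subseteq> P \<Longrightarrow> G S \<longleftrightarrow> G (S - A)"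
  shows "measure_pmf.prob (random_subset w P) {S. E S \<and> G S}
      = measure_pmf.prob (random_subset w P) {S. E S} * measure_pmf.prob (random_subset w P) {S. G S}"
proof -
  let ?prob = "measure_pmf.prob (random_subset w P)"
  have "?prob {S. E S \<and> G S} = ?prob {S. S \<subseteq> P \<and> E (S \<inter> A) \<and> G (S - A)}"
    using E G by (intro prob_random_subset_cong P) blast
  also have "\<dots> = ?prob ((\<lambda>S. (S \<inter> A, S - A)) -` ({S. S \<subseteq> P \<and> E S} \<times> {S. S \<subseteq> P \<and> G S}))"
    by (rule arg_cong[of _ _ ?prob]) auto
  also have "\<dots> = measure_pmf.prob (random_subset w (P \<inter> A)) {S. S \<subseteq> P \<and> E S}
      * measure_pmf.prob (random_subset w (P - A)) {S. S \<subseteq> P \<and> G S}"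
    unfolding measure_map_pmf[symmetric] random_subset_split[OF P]
    using P by (intro measure_pmf_prob_product countable_finite) auto
  also have "measure_pmf.prob (random_subset w (P \<inter> A)) {S. S \<subseteq> P \<and> E S} = ?prob {S. E S}"
    unfolding random_subset_Int[OF P, symmetric] measure_map_pmf vimage_def
    using E by (intro prob_random_subset_cong P) auto
  also have "measure_pmf.prob (random_subset w (P - A)) {S. S \<subseteq> P \<and> G S} = ?prob {S. G S}"
    unfolding random_subset_Diff[OF P, symmetric] measure_map_pmf vimage_def
    using G by (intro prob_random_subset_cong P) auto
  finally show ?thesis .
qed

section \<open>Gaps in a random set of primes\<close>

definition random_primes :: "nat \<Rightarrow> nat set pmf" where
  "random_primes y = random_subset (\<lambda>p. 1 / real p) (primes_in 0 y)"

lemma set_random_primes: "S \<in> set_pmf (random_primes y) \<Longrightarrow> S \<subseteq> primes_in 0 y"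
  unfolding random_primes_def by (rule set_random_subset[OF finite_primes_in])

definition gap_from :: "nat \<Rightarrow> nat \<Rightarrow> nat set \<Rightarrow> bool" where
  "gap_from K p S \<longleftrightarrow> S \<inter> {p..p ^ K} = {p}"

lemma gap_from_mem: "gap_from K p S \<Longrightarrow> p \<in> S"
  by (auto simp: gap_from_def)

lemma gap_from_iff:
  assumes "K > 0"
  shows "gap_from K p S \<longleftrightarrow> p \<in> S \<and> (\<forall>q\<in>S. p < q \<longrightarrow> p ^ K < q)"
proof -
  have "p \<le> p ^ K" using assms self_le_power[of p K] by (cases "p = 0") auto
  then have "{p..p ^ K} = insert p {p<..p ^ K}" by auto
  then have "gap_from K p S \<longleftrightarrow> p \<in> S \<and> S \<inter> {p<..p ^ K} = {}"
    unfolding gap_from_def by (auto simp: Int_insert_right)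
  then show ?thesis by (auto simp: disjoint_iff not_le)
qed

definition gap_prob :: "nat \<Rightarrow> nat \<Rightarrow> real" where
  "gap_prob K p = measure_pmf.prob (random_primes (p ^ K)) {S. gap_from K p S}"

lemma gap_prob_nonneg: "0 \<le> gap_prob K p"
  by (simp add: gap_prob_def)

lemma gap_prob_le_1: "gap_prob K p \<le> 1"
  by (simp add: gap_prob_def)

lemma prob_gap_from:
  assumes "p ^ K \<le> y"
  shows "measure_pmf.prob (random_primes y) {S. gap_from K p S} = gap_prob K p"
proof -
  have "gap_from K p (S \<inter> {..p ^ K}) \<longleftrightarrow> gap_from K p S" for S
    unfolding gap_from_def by (rule arg_cong[of _ _ "\<lambda>A. A = {p}"]) auto
  then have "measure_pmf.prob (random_primes y) {S. gap_from K p S}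
      = measure_pmf.prob (map_pmf (\<lambda>S. S \<inter> {..p ^ K}) (random_primes y)) {S. gap_from K p S}"
    by (simp add: vimage_def)
  also have "map_pmf (\<lambda>S. S \<inter> {..p ^ K}) (random_primes y) = random_primes (p ^ K)"
  proof -
    have "primes_in 0 y \<inter> {..p ^ K} = primes_in 0 (p ^ K)"
      using assms by (auto simp: primes_in_def)
    then show ?thesis by (simp add: random_primes_def random_subset_Int)
  qed
  finally show ?thesis by (simp add: gap_prob_def)
qed

lemma gap_prob_prime:
  assumes "prime p" "K > 0"
  shows "gap_prob K p = euler_prod p (p ^ K) / p"
proof -
  have "p \<le> p ^ K" using assms by (simp add: prime_gt_0_nat self_le_power Suc_leI)
  then have window: "primes_in 0 (p ^ K) \<inter> {p..p ^ K} = insert p (primes_in p (p ^ K))"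
    using assms by (auto simp: primes_in_def prime_gt_0_nat)
  have "gap_prob K p = pmf (map_pmf (\<lambda>S. S \<inter> {p..p ^ K}) (random_primes (p ^ K))) {p}"
    by (simp add: gap_prob_def pmf_map gap_from_def vimage_def)
  also have "\<dots> = pmf (random_subset (\<lambda>p. 1 / real p) (insert p (primes_in p (p ^ K)))) {p}"
    by (simp add: random_primes_def random_subset_Int window)
  also have "\<dots> = euler_prod p (p ^ K) / p"
    using assms(1) prime_ge_2_nat[OF assms(1)] primes_in_ge2
    by (subst pmf_random_subset) (auto simp: euler_prod_def primes_in_def)
  finally show ?thesis .
qed

lemma gap_prob_not_prime:
  assumes "\<not> prime p"
  shows "gap_prob K p = 0"
  unfolding gap_prob_def measure_pmf_zero_iff
  using assms by (auto simp: primes_in_def dest!: set_random_primes gap_from_mem)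

lemma gap_prob_bounds:
  assumes "prime p" "K > 0"
  shows "exp (- mertens_error p) / p / K \<le> gap_prob K p"
    "gap_prob K p \<le> exp (mertens_error p) / p / K"
proof -
  have "2 \<le> p" "p \<le> p ^ K"
    using assms by (auto simp: prime_ge_2_nat prime_gt_0_nat self_le_power Suc_leI)
  moreover have "log p (p ^ K) = K" using \<open>2 \<le> p\<close> by simp
  ultimately have "exp (- mertens_error p) / K \<le> euler_prod p (p ^ K)"
      "euler_prod p (p ^ K) \<le> exp (mertens_error p) / K"
    using mertens_third[of p "p ^ K"] by auto
  from this[THEN divide_right_mono, of "real p"]
  show "exp (- mertens_error p) / p / K \<le> gap_prob K p"
    "gap_prob K p \<le> exp (mertens_error p) / p / K"
    by (simp_all add: gap_prob_prime[OF assms] mult.commute)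
qed

lemma gap_prob_le_uniform:
  assumes "K > 0"
  shows "gap_prob K p \<le> exp (mertens_error 2) / p / K"
proof (cases "prime p")
  case True
  have "gap_prob K p \<le> exp (mertens_error p) / p / K" using True assms by (rule gap_prob_bounds)
  also have "\<dots> \<le> exp (mertens_error 2) / p / K"
    using True by (intro divide_right_mono) (auto intro: mertens_error_antimono prime_ge_2_nat)
  finally show ?thesis .
qed (simp add: gap_prob_not_prime)

definition no_gap_prob :: "nat \<Rightarrow> nat \<Rightarrow> nat \<Rightarrow> real" where
  "no_gap_prob y K m = measure_pmf.prob (random_primes y) {S. \<forall>p\<le>m. \<not> gap_from K p S}"

definition no_closed_gap_prob :: "nat \<Rightarrow> nat \<Rightarrow> nat \<Rightarrow> real" where
  "no_closed_gap_prob y K m =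
     measure_pmf.prob (random_primes y) {S. \<forall>p. p ^ K \<le> m \<longrightarrow> \<not> gap_from K p S}"

lemma le_of_power_le:
  fixes q m K :: nat
  assumes "q ^ K \<le> m" "K > 0"
  shows "q \<le> m"
  using assms self_le_power[of q K] by (cases "q = 0") auto

text \<open>If a gap opens at \<open>Suc m\<close>, then \<open>Suc m\<close> is present and every earlier gap has ended by \<open>m\<close>.
  That no earlier gap opens thus becomes a condition on the primes up to \<open>m\<close> alone, which is
  independent of the gap at \<open>Suc m\<close>.\<close>

lemma no_gap_prob_Suc:
  assumes y: "Suc m ^ K \<le> y" and K: "K > 0"
  shows "no_gap_prob y K (Suc m)
      = no_gap_prob y K m - gap_prob K (Suc m) * no_closed_gap_prob y K m"
proof -
  let ?prob = "measure_pmf.prob (random_primes y)"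
  let ?none = "\<lambda>m S. \<forall>p\<le>m. \<not> gap_from K p S"
  let ?none_closed = "\<lambda>S. \<forall>p. p ^ K \<le> m \<longrightarrow> \<not> gap_from K p S"
  have "{S. ?none m S} - {S. ?none (Suc m) S} = {S. gap_from K (Suc m) S \<and> ?none_closed S}"
  proof (intro equalityI subsetI)
    fix S assume S: "S \<in> {S. gap_from K (Suc m) S \<and> ?none_closed S}"
    have "p ^ K \<le> m" if "p \<le> m" "gap_from K p S" for p
    proof -
      have "Suc m \<in> S" using S gap_from_mem by blast
      with that have "p ^ K < Suc m" by (auto simp: gap_from_iff[OF K])
      then show ?thesis by simp
    qed
    with S show "S \<in> {S. ?none m S} - {S. ?none (Suc m) S}" by auto
  qed (use le_of_power_le[OF _ K, of _ m] in \<open>auto simp: le_Suc_eq\<close>)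
  then have "no_gap_prob y K m - no_gap_prob y K (Suc m)
      = ?prob {S. gap_from K (Suc m) S \<and> ?none_closed S}"
    unfolding no_gap_prob_def by (subst measure_pmf.finite_measure_Diff[symmetric]) auto
  also have "\<dots> = ?prob {S. gap_from K (Suc m) S} * ?prob {S. ?none_closed S}"
    unfolding random_primes_def
  proof (rule prob_random_subset_indep[where A = "{m<..}"])
    fix S
    have "gap_from K p S \<longleftrightarrow> gap_from K p (S - {m<..})" if "p ^ K \<le> m" for p
      unfolding gap_from_def using that by (intro arg_cong[of _ _ "\<lambda>A. A = {p}"]) auto
    then show "?none_closed S \<longleftrightarrow> ?none_closed (S - {m<..})" by blast
    show "gap_from K (Suc m) S \<longleftrightarrow> gap_from K (Suc m) (S \<inter> {m<..})"
      unfolding gap_from_def by (rule arg_cong[of _ _ "\<lambda>A. A = {Suc m}"]) auto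
  qed simp
  finally show ?thesis by (simp add: prob_gap_from[OF y] no_closed_gap_prob_def)
qed

lemma no_gap_prob_0:
  assumes "K > 0"
  shows "no_gap_prob y K 0 = 1 - gap_prob K 0"
proof -
  have "no_gap_prob y K 0 = 1 - measure_pmf.prob (random_primes y) {S. gap_from K 0 S}"
    using measure_pmf.prob_compl[of "{S. gap_from K 0 S}" "random_primes y"]
    by (simp add: no_gap_prob_def Compl_eq_Diff_UNIV[symmetric] Collect_neg_eq)
  then show ?thesis using assms by (simp add: prob_gap_from zero_power)
qed

lemma abs_recursion_diff_prod_le:
  fixes F G a :: "nat \<Rightarrow> real"
  assumes base: "F 0 = 1 - a 0" and step: "\<And>i. i < m \<Longrightarrow> F (Suc i) = F i - a (Suc i) * G i"
    and close: "\<And>i. i < m \<Longrightarrow> \<bar>G i - F i\<bar> \<le> \<delta>" and a: "\<And>i. 0 \<le> a i \<and> a i \<le> 1" and "0 \<le> \<delta>"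
  shows "\<bar>F m - (\<Prod>i\<le>m. 1 - a i)\<bar> \<le> \<delta> * (\<Sum>i\<le>m. a i)"
  using step close
proof (induction m)
  case 0
  then show ?case using base a[of 0] \<open>0 \<le> \<delta>\<close> by simp
next
  case (Suc m)
  let ?P = "\<Prod>i\<le>m. 1 - a i"
  have "F (Suc m) - (\<Prod>i\<le>Suc m. 1 - a i) = (1 - a (Suc m)) * (F m - ?P) - a (Suc m) * (G m - F m)"
    using Suc.prems(1)[of m] by (simp add: algebra_simps)
  also have "\<bar>\<dots>\<bar> \<le> \<bar>(1 - a (Suc m)) * (F m - ?P)\<bar> + \<bar>a (Suc m) * (G m - F m)\<bar>"
    by (rule abs_triangle_ineq4)
  also have "\<dots> = (1 - a (Suc m)) * \<bar>F m - ?P\<bar> + a (Suc m) * \<bar>G m - F m\<bar>"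
    using a[of "Suc m"] by (simp add: abs_mult)
  also have "\<dots> \<le> 1 * (\<delta> * (\<Sum>i\<le>m. a i)) + a (Suc m) * \<delta>"
    using a[of "Suc m"] Suc by (intro add_mono mult_mono) auto
  finally show ?case by (simp add: algebra_simps)
qed

lemma prime_recip_sum_window_le:
  assumes "finite Q" "\<And>q. q \<in> Q \<Longrightarrow> prime q" "\<And>q r. q \<in> Q \<Longrightarrow> r \<in> Q \<Longrightarrow> r \<le> q ^ K" "K > 0"
  shows "recip_sum Q \<le> 1 + ln K + mertens_error 2"
proof (cases "Q = {}")
  case False
  define z where "z = Min Q"
  have z: "z \<in> Q" unfolding z_def using assms(1) False by (rule Min_in)
  then have z2: "2 \<le> z" "z \<le> z ^ K" using assms(2-4) prime_ge_2_nat by auto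
  have "z \<le> q" if "q \<in> Q" for q unfolding z_def using assms(1) that by (rule Min_le)
  then have "Q \<subseteq> insert z (primes_in z (z ^ K))"
    using assms(2) assms(3)[OF z] by (auto simp: primes_in_def order.strict_iff_order)
  then have "recip_sum Q \<le> recip_sum (insert z (primes_in z (z ^ K)))"
    unfolding recip_sum_def by (intro sum_mono2) auto
  also have "\<dots> = 1 / z + prime_recip_sum z (z ^ K)"
    unfolding recip_sum_def by (subst sum.insert) (auto simp: primes_in_def)
  also have "\<dots> \<le> 1 + (ln (log z (z ^ K)) + mertens_error z)"
    using abs_prime_recip_sum_diff_le[OF z2] z2 by (intro add_mono) auto
  also have "\<dots> \<le> 1 + (ln K + mertens_error 2)"
    using z2 mertens_error_antimono[of 2 z] by simp
  finally show ?thesis by simp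
qed (use assms(4) mertens_error_nonneg[of 2] in \<open>simp add: recip_sum_def\<close>)

text \<open>Bounds the expected number of gaps that are open at a given point.\<close>

definition gap_overlap :: "nat \<Rightarrow> real" where
  "gap_overlap K = exp (mertens_error 2) * (1 + ln K + mertens_error 2) / K"

lemma gap_overlap_tendsto_0: "gap_overlap \<longlonglongrightarrow> 0"
  unfolding gap_overlap_def by real_asymp

lemma gap_overlap_nonneg: "0 \<le> gap_overlap K"
  using mertens_error_nonneg[of 2] by (cases "K = 0") (auto simp: gap_overlap_def)

lemma gap_prob_le_gap_overlap:
  assumes "K > 0"
  shows "gap_prob K p \<le> gap_overlap K"
proof (cases "p = 0")
  case False
  then have "1 / real p \<le> 1 + ln K + mertens_error 2"
    using assms mertens_error_nonneg[of 2] add_increasing2[of "ln K + mertens_error 2" "1 / p" 1]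
    by simp
  then have "exp (mertens_error 2) * (1 / p) / K \<le> gap_overlap K"
    unfolding gap_overlap_def by (intro divide_right_mono mult_left_mono) auto
  with gap_prob_le_uniform[OF assms, of p] show ?thesis by simp
qed (simp add: gap_prob_not_prime gap_overlap_nonneg)

lemma sum_gap_prob_window_le:
  assumes "K > 0"
  shows "(\<Sum>q | prime q \<and> q \<le> m \<and> m < q ^ K. gap_prob K q) \<le> gap_overlap K"
proof -
  let ?Q = "{q. prime q \<and> q \<le> m \<and> m < q ^ K}"
  have fin: "finite ?Q" by (rule finite_subset[of _ "{..m}"]) auto
  have "(\<Sum>q\<in>?Q. gap_prob K q) \<le> (\<Sum>q\<in>?Q. exp (mertens_error 2) / K * (1 / q))"
    using gap_prob_le_uniform[OF assms] by (intro sum_mono) (simp add: mult.commute)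
  also have "\<dots> = exp (mertens_error 2) / K * recip_sum ?Q"
    by (simp add: recip_sum_def sum_distrib_left)
  also have "\<dots> \<le> exp (mertens_error 2) / K * (1 + ln K + mertens_error 2)"
    using assms by (intro mult_left_mono prime_recip_sum_window_le fin) auto
  finally show ?thesis by (simp add: gap_overlap_def)
qed

lemma abs_no_closed_gap_prob_diff_le:
  assumes y: "m ^ K \<le> y" and K: "K > 0"
  shows "\<bar>no_closed_gap_prob y K m - no_gap_prob y K m\<bar> \<le> gap_overlap K"
proof -
  let ?prob = "measure_pmf.prob (random_primes y)"
  let ?none = "{S. \<forall>p\<le>m. \<not> gap_from K p S}"
  let ?none_closed = "{S. \<forall>p. p ^ K \<le> m \<longrightarrow> \<not> gap_from K p S}"
  let ?Q = "{q. prime q \<and> q \<le> m \<and> m < q ^ K}"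
  have finQ: "finite ?Q" by (rule finite_subset[of _ "{..m}"]) auto
  have sub: "?none \<subseteq> ?none_closed" using le_of_power_le[OF _ K] by blast
  have "no_gap_prob y K m \<le> no_closed_gap_prob y K m"
    unfolding no_gap_prob_def no_closed_gap_prob_def
    by (rule measure_pmf.finite_measure_mono[OF sub]) simp
  then have "\<bar>no_closed_gap_prob y K m - no_gap_prob y K m\<bar> = ?prob (?none_closed - ?none)"
    using measure_pmf.finite_measure_Diff[OF _ _ sub, of "random_primes y"]
    by (simp add: no_gap_prob_def no_closed_gap_prob_def)
  also have "\<dots> = ?prob ((?none_closed - ?none) \<inter> set_pmf (random_primes y))"
    by (simp add: measure_Int_set_pmf)
  also have "\<dots> \<le> ?prob (\<Union>q\<in>?Q. {S. gap_from K q S})"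
  proof (rule measure_pmf.finite_measure_mono)
    show "(?none_closed - ?none) \<inter> set_pmf (random_primes y) \<subseteq> (\<Union>q\<in>?Q. {S. gap_from K q S})"
    proof
      fix S assume S: "S \<in> (?none_closed - ?none) \<inter> set_pmf (random_primes y)"
      then obtain p where p: "p \<le> m" "gap_from K p S" "m < p ^ K" by (auto simp: not_le[symmetric])
      have "p \<in> primes_in 0 y"
        using S set_random_primes[of S y] gap_from_mem[OF p(2)] by blast
      then have "prime p" by (simp add: primes_in_def)
      with p show "S \<in> (\<Union>q\<in>?Q. {S. gap_from K q S})" by auto
    qed
  qed simp
  also have "\<dots> \<le> (\<Sum>q\<in>?Q. ?prob {S. gap_from K q S})"
    by (rule measure_pmf.finite_measure_subadditive_finite[OF finQ]) simp
  also have "\<dots> = (\<Sum>q\<in>?Q. gap_prob K q)"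
    using y by (intro sum.cong refl prob_gap_from) (auto intro: order_trans power_mono)
  also have "\<dots> \<le> gap_overlap K" using K by (rule sum_gap_prob_window_le)
  finally show ?thesis .
qed

lemma abs_prod_one_minus_diff_exp_le:
  fixes a :: "'a \<Rightarrow> real"
  assumes "\<And>i. i \<in> I \<Longrightarrow> 0 \<le> a i \<and> a i \<le> 1"
  shows "\<bar>(\<Prod>i\<in>I. 1 - a i) - exp (- (\<Sum>i\<in>I. a i))\<bar> \<le> (\<Sum>i\<in>I. (a i)\<^sup>2)"
proof (cases "finite I")
  case True
  have factor: "\<bar>1 - x - exp (- x)\<bar> \<le> x\<^sup>2" if "0 \<le> x" for x :: real
  proof -
    have "exp (- x) \<le> 1 / (1 + x)"
      using exp_ge_add_one_self[of x] that by (simp add: exp_minus field_simps)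
    also have "\<dots> \<le> 1 - x + x\<^sup>2" using that by (simp add: field_simps power2_eq_square)
    finally show ?thesis using exp_ge_add_one_self[of "- x"] by simp
  qed
  have "norm ((\<Prod>i\<in>I. 1 - a i) - (\<Prod>i\<in>I. exp (- a i))) \<le> (\<Sum>i\<in>I. norm (1 - a i - exp (- a i)))"
    using assms by (intro norm_prod_diff) auto
  also have "\<dots> \<le> (\<Sum>i\<in>I. (a i)\<^sup>2)" using assms factor by (intro sum_mono) auto
  finally show ?thesis using True by (simp add: exp_sum flip: sum_negf)
qed simp

lemma abs_no_gap_prob_diff_exp_le:
  assumes y: "m ^ K \<le> y" and K: "K > 0"
  defines "s \<equiv> (\<Sum>p\<le>m. gap_prob K p)"
  shows "\<bar>no_gap_prob y K m - exp (- s)\<bar> \<le> 2 * gap_overlap K * s"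
proof -
  have a: "0 \<le> gap_prob K p \<and> gap_prob K p \<le> 1" for p by (simp add: gap_prob_nonneg gap_prob_le_1)
  have "\<bar>no_gap_prob y K m - (\<Prod>p\<le>m. 1 - gap_prob K p)\<bar> \<le> gap_overlap K * s"
    unfolding s_def
  proof (rule abs_recursion_diff_prod_le[where G = "no_closed_gap_prob y K"])
    fix i assume "i < m"
    then have "Suc i ^ K \<le> m ^ K" "i ^ K \<le> m ^ K" by (auto intro: power_mono simp del: power_Suc)
    with y have "Suc i ^ K \<le> y" "i ^ K \<le> y" by auto
    then show "no_gap_prob y K (Suc i)
        = no_gap_prob y K i - gap_prob K (Suc i) * no_closed_gap_prob y K i"
      "\<bar>no_closed_gap_prob y K i - no_gap_prob y K i\<bar> \<le> gap_overlap K"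
      using K by (auto intro: no_gap_prob_Suc abs_no_closed_gap_prob_diff_le)
  qed (use a K in \<open>auto simp: no_gap_prob_0 gap_overlap_nonneg\<close>)
  moreover have "\<bar>(\<Prod>p\<le>m. 1 - gap_prob K p) - exp (- s)\<bar> \<le> (\<Sum>p\<le>m. (gap_prob K p)\<^sup>2)"
    unfolding s_def using a by (rule abs_prod_one_minus_diff_exp_le)
  moreover have "(\<Sum>p\<le>m. (gap_prob K p)\<^sup>2) \<le> gap_overlap K * s"
    unfolding s_def sum_distrib_left power2_eq_square
    using gap_prob_le_gap_overlap[OF K]
    by (intro sum_mono mult_right_mono) (auto simp: gap_prob_nonneg)
  ultimately show ?thesis by linarith
qed

lemma sum_gap_prob_bounds:
  assumes "K > 0"
  shows "(\<Sum>p\<in>primes_in 0 m. exp (- mertens_error p) / p) / K \<le> (\<Sum>p\<le>m. gap_prob K p)"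
    and "(\<Sum>p\<le>m. gap_prob K p) \<le> (\<Sum>p\<in>primes_in 0 m. exp (mertens_error p) / p) / K"
proof -
  have "(\<Sum>p\<le>m. gap_prob K p) = (\<Sum>p\<in>primes_in 0 m. gap_prob K p)"
    by (rule sum.mono_neutral_right)
       (auto simp: primes_in_def gap_prob_not_prime intro!: gap_prob_not_prime Nat.gr0I)
  with gap_prob_bounds[OF _ assms]
  show "(\<Sum>p\<in>primes_in 0 m. exp (- mertens_error p) / p) / K \<le> (\<Sum>p\<le>m. gap_prob K p)"
    "(\<Sum>p\<le>m. gap_prob K p) \<le> (\<Sum>p\<in>primes_in 0 m. exp (mertens_error p) / p) / K"
    by (auto simp: sum_divide_distrib primes_in_def intro!: sum_mono)
qed

context
  fixes K m :: "nat \<Rightarrow> nat" and L :: real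
  assumes K: "filterlim K at_top sequentially" and m: "filterlim m at_top sequentially"
    and L: "(\<lambda>N. ln (ln (m N)) / K N) \<longlonglongrightarrow> L"
begin

lemma sum_gap_prob_tendsto: "(\<lambda>N. \<Sum>p\<le>m N. gap_prob (K N) p) \<longlonglongrightarrow> L"
proof (rule tendsto_sandwich)
  have K_pos: "eventually (\<lambda>N. K N > 0) sequentially"
    using eventually_gt_at_top K by (rule eventually_compose_filterlim)
  show "eventually (\<lambda>N. (\<Sum>p\<in>primes_in 0 (m N). exp (- mertens_error p) / p) / K N
      \<le> (\<Sum>p\<le>m N. gap_prob (K N) p)) sequentially"
    using K_pos by eventually_elim (rule sum_gap_prob_bounds)
  show "eventually (\<lambda>N. (\<Sum>p\<le>m N. gap_prob (K N) p)
      \<le> (\<Sum>p\<in>primes_in 0 (m N). exp (mertens_error p) / p) / K N) sequentially"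
    using K_pos by eventually_elim (rule sum_gap_prob_bounds)
  have weighted: "(\<lambda>N. (\<Sum>p\<in>primes_in 0 (m N). x p / p) / K N) \<longlonglongrightarrow> L" if "x \<longlonglongrightarrow> 1" for x :: "nat \<Rightarrow> real"
  proof -
    let ?W = "\<lambda>m. (\<Sum>p\<in>primes_in 0 m. x p / p)"
    have "(\<lambda>N. ?W (m N) / ln (ln (m N)) * (ln (ln (m N)) / K N)) \<longlonglongrightarrow> 1 * L"
      by (intro tendsto_mult L filterlim_compose[OF weighted_prime_recip_sum_asymp[OF that] m])
    moreover have "eventually (\<lambda>N. ln (ln (m N)) > 0) sequentially"
      using eventually_ln_ln_pos m by (rule eventually_compose_filterlim)
    then have "eventually (\<lambda>N. ?W (m N) / ln (ln (m N)) * (ln (ln (m N)) / K N)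
        = ?W (m N) / K N) sequentially"
      by eventually_elim simp
    ultimately show ?thesis by (simp add: Lim_transform_eventually)
  qed
  have "(\<lambda>p. exp (c * mertens_error p)) \<longlonglongrightarrow> 1" for c
    using tendsto_exp[OF tendsto_mult_right_zero[OF mertens_error_tendsto_0]] by simp
  from this[of 1] this[of "- 1"]
  show "(\<lambda>N. (\<Sum>p\<in>primes_in 0 (m N). exp (mertens_error p) / p) / K N) \<longlonglongrightarrow> L"
    "(\<lambda>N. (\<Sum>p\<in>primes_in 0 (m N). exp (- mertens_error p) / p) / K N) \<longlonglongrightarrow> L"
    by (simp_all add: weighted)
qed

lemma no_gap_prob_tendsto:
  assumes y: "eventually (\<lambda>N. m N ^ K N \<le> y N) sequentially"
  shows "(\<lambda>N. no_gap_prob (y N) (K N) (m N)) \<longlonglongrightarrow> exp (- L)"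
proof -
  define s where "s N = (\<Sum>p\<le>m N. gap_prob (K N) p)" for N
  have s: "s \<longlonglongrightarrow> L" unfolding s_def by (rule sum_gap_prob_tendsto)
  show ?thesis
  proof (rule Lim_transform)
    show "(\<lambda>N. exp (- s N)) \<longlonglongrightarrow> exp (- L)" by (intro tendsto_intros s)
    show "(\<lambda>N. no_gap_prob (y N) (K N) (m N) - exp (- s N)) \<longlonglongrightarrow> 0"
    proof (rule Lim_null_comparison)
      show "(\<lambda>N. 2 * gap_overlap (K N) * s N) \<longlonglongrightarrow> 0"
        using tendsto_mult[OF tendsto_mult_right_zero[OF filterlim_compose[OF gap_overlap_tendsto_0 K]] s]
        by simp
      have "eventually (\<lambda>N. K N > 0) sequentially"
        using eventually_gt_at_top K by (rule eventually_compose_filterlim)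
      with y show "eventually (\<lambda>N. norm (no_gap_prob (y N) (K N) (m N) - exp (- s N))
          \<le> 2 * gap_overlap (K N) * s N) sequentially"
        by eventually_elim (simp add: s_def abs_no_gap_prob_diff_exp_le)
    qed
  qed
qed

end

section \<open>Densities of initial segments\<close>

definition density_upto :: "nat \<Rightarrow> nat set \<Rightarrow> real" where
  "density_upto N A = card (A \<inter> {1..N}) / N"

lemma density_upto_eq_prob: "N > 0 \<Longrightarrow> density_upto N A = measure_pmf.prob (pmf_of_set {1..N}) A"
  by (simp add: density_upto_def measure_pmf_of_set Int_commute)

lemma density_upto_mono:
  assumes "A \<inter> {1..N} \<subseteq> B"
  shows "density_upto N A \<le> density_upto N B"
proof -
  have "card (A \<inter> {1..N}) \<le> card (B \<inter> {1..N})" using assms by (intro card_mono) auto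
  then show ?thesis by (simp add: density_upto_def divide_right_mono)
qed

lemma density_upto_Un_le: "density_upto N (A \<union> B) \<le> density_upto N A + density_upto N B"
proof -
  have "card ((A \<union> B) \<inter> {1..N}) \<le> card (A \<inter> {1..N}) + card (B \<inter> {1..N})"
    unfolding Int_Un_distrib2 by (rule card_Un_le)
  then have "real (card ((A \<union> B) \<inter> {1..N})) \<le> card (A \<inter> {1..N}) + card (B \<inter> {1..N})"
    by (simp flip: of_nat_add)
  then show ?thesis by (simp add: density_upto_def divide_right_mono flip: add_divide_distrib)
qed

lemma density_upto_UN_le:
  assumes "finite I"
  shows "density_upto N (\<Union>i\<in>I. A i) \<le> (\<Sum>i\<in>I. density_upto N (A i))"
  using assms
proof (induction I rule: finite_induct)
  case (insert i I)
  have "density_upto N (\<Union>i\<in>insert i I. A i) \<le> density_upto N (A i) + density_upto N (\<Union>i\<in>I. A i)"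
    unfolding UN_insert by (rule density_upto_Un_le)
  with insert show ?case by simp
qed (simp add: density_upto_def)

section \<open>Brun's sieve\<close>

definition bonferroni_sum :: "('a \<Rightarrow> real) \<Rightarrow> 'a set \<Rightarrow> nat \<Rightarrow> real" where
  "bonferroni_sum w Q r = (\<Sum>D | D \<subseteq> Q \<and> card D \<le> r. \<Prod>x\<in>D. - w x)"

lemma bonferroni_sum_insert:
  assumes "finite Q" "q \<notin> Q"
  shows "bonferroni_sum w (insert q Q) (Suc r)
      = bonferroni_sum w Q (Suc r) - w q * bonferroni_sum w Q r"
proof -
  let ?without = "{D. D \<subseteq> Q \<and> card D \<le> Suc r}" and ?rest = "{D. D \<subseteq> Q \<and> card D \<le> r}"
  have fin: "finite D" if "D \<subseteq> Q" for D using that assms(1) by (rule finite_subset)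
  have notin: "q \<notin> D" if "D \<subseteq> Q" for D using that assms(2) by blast
  have "{D. D \<subseteq> insert q Q \<and> card D \<le> Suc r} = {D\<in>Pow (insert q Q). card D \<le> Suc r}" by auto
  also have "\<dots> = ?without \<union> insert q ` {D. D \<subseteq> Q \<and> card (insert q D) \<le> Suc r}"
    unfolding Pow_insert by auto
  also have "{D. D \<subseteq> Q \<and> card (insert q D) \<le> Suc r} = ?rest"
    using fin notin by auto
  finally have "{D. D \<subseteq> insert q Q \<and> card D \<le> Suc r} = ?without \<union> insert q ` ?rest" .
  moreover have "?without \<inter> insert q ` ?rest = {}" using assms(2) by auto
  ultimately have "bonferroni_sum w (insert q Q) (Suc r)
      = bonferroni_sum w Q (Suc r) + (\<Sum>D\<in>insert q ` ?rest. \<Prod>x\<in>D. - w x)"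
    unfolding bonferroni_sum_def using assms(1) by (simp add: sum.union_disjoint)
  also have "(\<Sum>D\<in>insert q ` ?rest. \<Prod>x\<in>D. - w x) = (\<Sum>D\<in>?rest. \<Prod>x\<in>insert q D. - w x)"
    using assms(2) by (subst sum.reindex) (auto simp: inj_on_def)
  also have "\<dots> = - w q * bonferroni_sum w Q r"
    unfolding bonferroni_sum_def sum_distrib_left
    using fin notin by (intro sum.cong) auto
  finally show ?thesis by simp
qed

text \<open>Stated for arbitrary weights in the unit interval: it is applied both to \<open>1 / d\<close> and to the
  indicator of \<open>d dvd n\<close>.\<close>

lemma bonferroni_inequalities:
  assumes "finite Q" "\<And>x. x \<in> Q \<Longrightarrow> 0 \<le> w x \<and> w x \<le> 1"
  shows "even r \<Longrightarrow> (\<Prod>x\<in>Q. 1 - w x) \<le> bonferroni_sum w Q r"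
    and "odd r \<Longrightarrow> bonferroni_sum w Q r \<le> (\<Prod>x\<in>Q. 1 - w x)"
proof -
  have "(if even r then (\<Prod>x\<in>Q. 1 - w x) \<le> bonferroni_sum w Q r
         else bonferroni_sum w Q r \<le> (\<Prod>x\<in>Q. 1 - w x))"
    using assms
  proof (induction Q arbitrary: r rule: finite_induct)
    case empty
    have "{D :: 'a set. D \<subseteq> {} \<and> card D \<le> r} = {{}}" by auto
    then show ?case by (simp add: bonferroni_sum_def)
  next
    case (insert q Q)
    show ?case
    proof (cases r)
      case 0
      have "{D. D \<subseteq> insert q Q \<and> card D \<le> 0} = {{}}"
        using insert.hyps by (auto dest: finite_subset)
      then have "bonferroni_sum w (insert q Q) 0 = 1" by (simp add: bonferroni_sum_def)
      moreover have "(\<Prod>x\<in>insert q Q. 1 - w x) \<le> 1" using insert.prems by (intro prod_le_1) auto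
      ultimately show ?thesis using 0 by simp
    next
      case (Suc s)
      have "(\<Prod>x\<in>insert q Q. 1 - w x) = (\<Prod>x\<in>Q. 1 - w x) - w q * (\<Prod>x\<in>Q. 1 - w x)"
        using insert.hyps by (simp add: algebra_simps)
      then show ?thesis
        using insert.IH[of s] insert.IH[of "Suc s"] insert.prems mult_left_mono[of _ _ "w q"]
        unfolding Suc bonferroni_sum_insert[OF insert.hyps]
        by (auto intro!: diff_mono split: if_splits)
    qed
  qed
  then show "even r \<Longrightarrow> (\<Prod>x\<in>Q. 1 - w x) \<le> bonferroni_sum w Q r"
    and "odd r \<Longrightarrow> bonferroni_sum w Q r \<le> (\<Prod>x\<in>Q. 1 - w x)"
    by (simp_all split: if_splits)
qed

lemma bonferroni_sum_ge:
  assumes "finite Q" "\<And>x. x \<in> Q \<Longrightarrow> 0 \<le> w x \<and> w x \<le> 1" "odd r"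
  shows "(\<Prod>x\<in>Q. 1 - w x) - (\<Sum>D | D \<subseteq> Q \<and> r < card D. prod w D) \<le> bonferroni_sum w Q r"
proof -
  let ?next = "{D. D \<subseteq> Q \<and> card D = Suc r}"
  have "(\<Prod>x\<in>Q. 1 - w x) \<le> bonferroni_sum w Q (Suc r)"
    using assms by (intro bonferroni_inequalities) auto
  also have "{D. D \<subseteq> Q \<and> card D \<le> Suc r} = {D. D \<subseteq> Q \<and> card D \<le> r} \<union> ?next" by auto
  then have "bonferroni_sum w Q (Suc r) = bonferroni_sum w Q r + (\<Sum>D\<in>?next. \<Prod>x\<in>D. - w x)"
    unfolding bonferroni_sum_def using assms(1) by (simp add: sum.union_disjoint disjoint_iff)
  also have "(\<Sum>D\<in>?next. \<Prod>x\<in>D. - w x) = (\<Sum>D\<in>?next. prod w D)"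
    using assms(3) by (intro sum.cong) (auto simp: prod_uminus)
  also have "\<dots> \<le> (\<Sum>D | D \<subseteq> Q \<and> r < card D. prod w D)"
    using assms by (intro sum_mono2) (auto intro!: prod_nonneg)
  finally show ?thesis by simp
qed

lemma sum_subsets_prod_le_exp:
  fixes w :: "'a \<Rightarrow> real"
  assumes "finite P" "\<And>x. x \<in> P \<Longrightarrow> 0 \<le> w x"
  shows "(\<Sum>D\<in>Pow P. prod w D) \<le> exp (sum w P)"
  using prod_add[OF assms(1), of w "\<lambda>_. 1"] prod_le_exp_sum[of P w] assms(2)
  by (simp add: add.commute)

text \<open>Rankin's trick: \<open>b ^ card D / b ^ r\<close> is at least \<open>1\<close> on the sets that are counted.\<close>

lemma sum_large_subsets_le:
  fixes w :: "'a \<Rightarrow> real"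
  assumes "finite P" "\<And>x. x \<in> P \<Longrightarrow> 0 \<le> w x" "b \<ge> 1"
  shows "(\<Sum>D | D \<subseteq> P \<and> r < card D. prod w D) \<le> exp (b * sum w P) / b ^ r"
proof -
  have nonneg: "0 \<le> prod w D" if "D \<subseteq> P" for D using that assms(2) by (intro prod_nonneg) auto
  have scale: "(\<Prod>x\<in>D. b * w x) = b ^ card D * prod w D" for D by (simp add: prod.distrib)
  have "(\<Sum>D | D \<subseteq> P \<and> r < card D. prod w D) \<le> (\<Sum>D | D \<subseteq> P \<and> r < card D. (\<Prod>x\<in>D. b * w x) / b ^ r)"
  proof (intro sum_mono)
    fix D assume D: "D \<in> {D. D \<subseteq> P \<and> r < card D}"
    then have "b ^ r * prod w D \<le> (\<Prod>x\<in>D. b * w x)"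
      unfolding scale using nonneg assms(3) by (intro mult_right_mono power_increasing) auto
    then show "prod w D \<le> (\<Prod>x\<in>D. b * w x) / b ^ r" using assms(3) by (simp add: field_simps)
  qed
  also have "\<dots> \<le> (\<Sum>D\<in>Pow P. (\<Prod>x\<in>D. b * w x) / b ^ r)"
    using assms nonneg by (intro sum_mono2) (auto simp: scale)
  also have "\<dots> = (\<Sum>D\<in>Pow P. (\<Prod>x\<in>D. b * w x)) / b ^ r" by (simp add: sum_divide_distrib)
  also have "\<dots> \<le> exp (\<Sum>x\<in>P. b * w x) / b ^ r"
    using assms by (intro divide_right_mono sum_subsets_prod_le_exp) auto
  finally show ?thesis by (simp add: sum_distrib_left)
qed

lemma card_small_subsets_le:
  fixes y :: nat
  assumes "finite P" "\<And>d. d \<in> P \<Longrightarrow> 0 < d \<and> d \<le> y" "y > 0"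
  shows "real (card {D. D \<subseteq> P \<and> card D \<le> r}) \<le> real y ^ r * exp (recip_sum P)"
proof -
  let ?w = "\<lambda>d. 1 / real d"
  have "1 \<le> real y ^ r * prod ?w D" if D: "D \<subseteq> P" "card D \<le> r" for D
  proof -
    have "(\<Prod>d\<in>D. real d) \<le> (\<Prod>d\<in>D. real y)" using D assms(2) by (intro prod_mono) auto
    also have "\<dots> \<le> real y ^ r" using D assms(3) by (simp add: power_increasing)
    finally have "(\<Prod>d\<in>D. real d) \<le> real y ^ r" .
    moreover have "0 < (\<Prod>d\<in>D. real d)" using D assms(2) by (intro prod_pos) auto
    ultimately show ?thesis by (simp add: prod_dividef)
  qed
  then have "(\<Sum>D | D \<subseteq> P \<and> card D \<le> r. 1) \<le> (\<Sum>D | D \<subseteq> P \<and> card D \<le> r. real y ^ r * prod ?w D)"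
    by (intro sum_mono) auto
  also have "\<dots> \<le> (\<Sum>D\<in>Pow P. real y ^ r * prod ?w D)"
    using assms(1) by (intro sum_mono2) (auto intro!: mult_nonneg_nonneg prod_nonneg)
  also have "\<dots> \<le> real y ^ r * exp (recip_sum P)"
    unfolding sum_distrib_left[symmetric] recip_sum_def
    using assms(1) by (intro mult_left_mono sum_subsets_prod_le_exp) auto
  finally show ?thesis by simp
qed

definition divisors_in :: "nat set \<Rightarrow> nat \<Rightarrow> nat set" where
  "divisors_in P n = {d\<in>P. d dvd n}"

lemma prod_of_bool:
  assumes "finite A"
  shows "(\<Prod>x\<in>A. of_bool (R x) :: 'a :: linordered_idom) = of_bool (\<forall>x\<in>A. R x)"
  using assms by (induction A rule: finite_induct) auto

lemma sum_prod_dvd_indicators_ge: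
  fixes S D :: "nat set"
  assumes "finite (S \<union> D)" "S \<inter> D = {}" "pairwise coprime (S \<union> D)" "0 \<notin> S \<union> D"
  shows "real N * ((\<Prod>d\<in>S. 1 / real d) * (\<Prod>d\<in>D. - (1 / real d))) - 1
           \<le> (\<Sum>n=1..N. (\<Prod>d\<in>S. of_bool (d dvd n)) * (\<Prod>d\<in>D. - of_bool (d dvd n)))"
proof -
  have prod_Un: "(\<Prod>d\<in>S \<union> D. f d) = prod f S * prod f D" for f :: "nat \<Rightarrow> real"
    using assms(1,2) by (intro prod.union_disjoint) auto
  define m where "m = \<Prod>(S \<union> D)"
  have "0 < m" unfolding m_def using assms(4) by (intro prod_pos) (metis gr0I)
  have "(\<Sum>n=1..N. (\<Prod>d\<in>S. of_bool (d dvd n)) * (\<Prod>d\<in>D. - of_bool (d dvd n)))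
      = (-1) ^ card D * (\<Sum>n=1..N. \<Prod>d\<in>S \<union> D. of_bool (d dvd n) :: real)"
    by (simp only: prod_uminus prod_Un sum_distrib_left mult.left_commute)
  also have "\<dots> = (-1) ^ card D * (\<Sum>n=1..N. of_bool (m dvd n))"
    using assms(1,3) by (simp only: prod_of_bool m_def pairwise_coprime_prod_dvd_iff)
  also have "\<dots> = (-1) ^ card D * real (N div m)"
    using \<open>0 < m\<close> by (simp only: sum_dvd_indicator)
  also have "\<dots> \<ge> (-1) ^ card D * (real N / real m) - 1"
    using real_div_ge[of N m] of_nat_div_le_of_nat[of N m, where ?'a = real]
    by (cases "even (card D)") auto
  also have "(-1) ^ card D * (real N / real m)
      = real N * ((\<Prod>d\<in>S. 1 / real d) * (\<Prod>d\<in>D. - (1 / real d)))"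
    unfolding m_def of_nat_prod prod_Un by (simp add: prod_uminus prod_dividef)
  finally show ?thesis .
qed

lemma abs_prob_diff_le:
  assumes U: "finite U" "set_pmf M \<subseteq> U"
    and le: "\<And>x. x \<in> U \<Longrightarrow> pmf M x - pmf M' x \<le> t x" and t: "\<And>x. x \<in> U \<Longrightarrow> 0 \<le> t x"
  shows "\<bar>measure_pmf.prob M E - measure_pmf.prob M' E\<bar> \<le> sum t U"
proof -
  have one_sided: "measure_pmf.prob M E - measure_pmf.prob M' E \<le> sum t U" for E
  proof -
    have "measure_pmf.prob M E = measure_pmf.prob M (E \<inter> U)"
      using U(2) by (intro measure_prob_cong_0) (auto simp: pmf_eq_0_set_pmf)
    also have "\<dots> = (\<Sum>x\<in>E \<inter> U. pmf M x)" using U(1) by (simp add: measure_measure_pmf_finite)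
    also have "\<dots> \<le> (\<Sum>x\<in>E \<inter> U. pmf M' x + t x)"
      using le by (intro sum_mono) (auto simp: algebra_simps)
    also have "\<dots> = measure_pmf.prob M' (E \<inter> U) + (\<Sum>x\<in>E \<inter> U. t x)"
      using U(1) by (simp add: measure_measure_pmf_finite sum.distrib)
    also have "\<dots> \<le> measure_pmf.prob M' E + sum t U"
      using U(1) t by (intro add_mono measure_pmf.finite_measure_mono sum_mono2) auto
    finally show ?thesis by simp
  qed
  have "measure_pmf.prob M (- E) = 1 - measure_pmf.prob M E" for M :: "'a pmf"
    using measure_pmf.prob_compl[of E M] by (simp add: Compl_eq_Diff_UNIV)
  then show ?thesis using one_sided[of E] one_sided[of "- E"] by (simp add: abs_le_iff)
qed

text \<open>For small \<open>S\<close>, the two summands are the truncation error of the Bonferroni sum and the rounding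
  error.\<close>

definition sieve_error :: "nat set \<Rightarrow> nat \<Rightarrow> nat \<Rightarrow> nat \<Rightarrow> real \<Rightarrow> nat set \<Rightarrow> real" where
  "sieve_error P y N r b S =
     (if card S \<le> r
      then (\<Prod>d\<in>S. 1 / real d) * (exp (b * recip_sum P) / b ^ r) + real y ^ r * exp (recip_sum P) / N
      else (\<Prod>d\<in>S. 1 / real d))"

context
  fixes P :: "nat set" and y N :: nat
  assumes finite_P: "finite P" and coprime_P: "pairwise coprime P"
    and bounds_P: "\<And>d. d \<in> P \<Longrightarrow> 0 < d \<and> d \<le> y" and y_pos: "y > 0" and N_pos: "N > 0"
begin

lemma density_divisors_in_eq_ge:
  assumes S: "S \<subseteq> P" and "odd r"
  shows "(\<Prod>d\<in>S. 1 / real d) * bonferroni_sum (\<lambda>d. 1 / real d) (P - S) r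
           - card {D. D \<subseteq> P - S \<and> card D \<le> r} / N \<le> density_upto N {n. divisors_in P n = S}"
proof -
  let ?ind = "\<lambda>n d. of_bool (d dvd n) :: real" and ?small = "{D. D \<subseteq> P - S \<and> card D \<le> r}"
  have fin: "finite S" "finite (P - S)" using finite_subset[OF S finite_P] finite_P by auto
  have "real N * ((\<Prod>d\<in>S. 1 / real d) * bonferroni_sum (\<lambda>d. 1 / real d) (P - S) r) - card ?small
      = (\<Sum>D\<in>?small. real N * ((\<Prod>d\<in>S. 1 / real d) * (\<Prod>d\<in>D. - (1 / real d))) - 1)"
    by (simp add: bonferroni_sum_def sum_distrib_left sum_subtractf)
  also have "\<dots> \<le> (\<Sum>D\<in>?small. \<Sum>n=1..N. prod (?ind n) S * (\<Prod>d\<in>D. - ?ind n d))"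
  proof (intro sum_mono sum_prod_dvd_indicators_ge)
    fix D assume "D \<in> ?small"
    then have "S \<union> D \<subseteq> P" using S by auto
    then show "finite (S \<union> D)" "pairwise coprime (S \<union> D)" "0 \<notin> S \<union> D"
      using finite_subset[OF _ finite_P] pairwise_subset[OF coprime_P] bounds_P[of 0] by auto
  qed auto
  also have "\<dots> = (\<Sum>n=1..N. prod (?ind n) S * bonferroni_sum (?ind n) (P - S) r)"
    unfolding bonferroni_sum_def sum_distrib_left by (rule sum.swap)
  also have "\<dots> \<le> (\<Sum>n=1..N. prod (?ind n) S * (\<Prod>d\<in>P - S. 1 - ?ind n d))"
    using bonferroni_inequalities(2)[OF fin(2) _ \<open>odd r\<close>]
    by (intro sum_mono mult_left_mono) (auto intro!: prod_nonneg)
  also have "\<dots> = (\<Sum>n=1..N. of_bool (divisors_in P n = S))"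
  proof (rule sum.cong[OF refl])
    fix n
    have "(\<Prod>d\<in>P - S. 1 - ?ind n d) = (\<Prod>d\<in>P - S. of_bool (\<not> d dvd n))" by (intro prod.cong) auto
    then show "prod (?ind n) S * (\<Prod>d\<in>P - S. 1 - ?ind n d) = of_bool (divisors_in P n = S)"
      using S fin by (auto simp: prod_of_bool divisors_in_def)
  qed
  also have "\<dots> = real N * density_upto N {n. divisors_in P n = S}"
    using N_pos by (simp add: density_upto_def sum_of_bool_eq Int_def conj_commute)
  finally show ?thesis using N_pos by (simp add: field_simps)
qed

lemma pmf_minus_density_divisors_in_le:
  assumes S: "S \<subseteq> P" and "odd r" "b \<ge> 1"
  shows "pmf (random_subset (\<lambda>d. 1 / real d) P) S - density_upto N {n. divisors_in P n = S}
           \<le> (\<Prod>d\<in>S. 1 / real d) * (exp (b * recip_sum P) / b ^ r)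
             + real y ^ r * exp (recip_sum P) / N"
proof -
  let ?w = "\<lambda>d. 1 / real d" and ?tail = "exp (b * recip_sum P) / b ^ r"
  have w: "0 \<le> ?w d \<and> ?w d \<le> 1" if "d \<in> P" for d using bounds_P[OF that] by auto
  have "(\<Sum>D | D \<subseteq> P - S \<and> r < card D. prod ?w D) \<le> (\<Sum>D | D \<subseteq> P \<and> r < card D. prod ?w D)"
    using finite_P by (intro sum_mono2) (auto intro!: prod_nonneg)
  also have "\<dots> \<le> ?tail"
    unfolding recip_sum_def using finite_P assms(3) by (intro sum_large_subsets_le) auto
  finally have "(\<Prod>d\<in>P - S. 1 - ?w d) - bonferroni_sum ?w (P - S) r \<le> ?tail"
    using bonferroni_sum_ge[of "P - S" ?w r] finite_P w \<open>odd r\<close> by auto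
  then have "prod ?w S * ((\<Prod>d\<in>P - S. 1 - ?w d) - bonferroni_sum ?w (P - S) r) \<le> prod ?w S * ?tail"
    by (intro mult_left_mono) (auto intro!: prod_nonneg)
  moreover have "card {D. D \<subseteq> P - S \<and> card D \<le> r} \<le> card {D. D \<subseteq> P \<and> card D \<le> r}"
    using finite_P by (intro card_mono) auto
  then have "real (card {D. D \<subseteq> P - S \<and> card D \<le> r}) \<le> real y ^ r * exp (recip_sum P)"
    using card_small_subsets_le[OF finite_P bounds_P y_pos, of r] by linarith
  then have "card {D. D \<subseteq> P - S \<and> card D \<le> r} / N \<le> real y ^ r * exp (recip_sum P) / N"
    by (rule divide_right_mono) simp
  ultimately show ?thesis
    using density_divisors_in_eq_ge[OF assms(1,2)] pmf_random_subset[OF finite_P S w]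
    by (simp add: right_diff_distrib)
qed

lemma pmf_minus_density_divisors_in_le_sieve_error:
  assumes S: "S \<subseteq> P" and "odd r" "b \<ge> 1"
  shows "pmf (random_subset (\<lambda>d. 1 / real d) P) S - density_upto N {n. divisors_in P n = S}
           \<le> sieve_error P y N r b S"
proof (cases "card S \<le> r")
  case True
  with pmf_minus_density_divisors_in_le[OF assms] show ?thesis by (simp add: sieve_error_def)
next
  case False
  let ?w = "\<lambda>d. 1 / real d"
  have w: "0 \<le> ?w d \<and> ?w d \<le> 1" if "d \<in> P" for d using bounds_P[OF that] by auto
  have "(\<Prod>d\<in>P - S. 1 - ?w d) \<le> 1" using w by (intro prod_le_1) auto
  then have "pmf (random_subset ?w P) S \<le> prod ?w S"
    using pmf_random_subset[OF finite_P S w] by (simp add: mult_left_le prod_nonneg)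
  moreover have "0 \<le> density_upto N {n. divisors_in P n = S}" by (simp add: density_upto_def)
  ultimately show ?thesis using False by (simp add: sieve_error_def)
qed

lemma sum_sieve_error_le:
  assumes "b \<ge> 1"
  shows "(\<Sum>S\<in>Pow P. sieve_error P y N r b S)
           \<le> 2 * exp ((b + 1) * recip_sum P) / b ^ r + real y ^ (2 * r) * exp (2 * recip_sum P) / N"
proof -
  let ?w = "\<lambda>d. 1 / real d" and ?\<sigma> = "recip_sum P"
  let ?small = "{S. S \<subseteq> P \<and> card S \<le> r}" and ?large = "{S. S \<subseteq> P \<and> r < card S}"
  define tail where "tail = exp (b * ?\<sigma>) / b ^ r"
  define round where "round = real y ^ r * exp ?\<sigma> / N"
  have tail: "0 \<le> tail" and round: "0 \<le> round" using assms by (auto simp: tail_def round_def)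
  have "Pow P = ?small \<union> ?large" by auto
  then have "(\<Sum>S\<in>Pow P. sieve_error P y N r b S)
      = (\<Sum>S\<in>?small. sieve_error P y N r b S) + (\<Sum>S\<in>?large. sieve_error P y N r b S)"
    using finite_P by (simp add: sum.union_disjoint disjoint_iff)
  also have "\<dots> = (\<Sum>S\<in>?small. prod ?w S * tail + round) + (\<Sum>S\<in>?large. prod ?w S)"
    by (simp add: sieve_error_def tail_def round_def)
  also have "\<dots> = (\<Sum>S\<in>?small. prod ?w S) * tail + real (card ?small) * round
      + (\<Sum>S\<in>?large. prod ?w S)"
    by (simp add: sum.distrib sum_distrib_right)
  also have "\<dots> \<le> exp ?\<sigma> * tail + real y ^ r * exp ?\<sigma> * round + tail"
  proof (intro add_mono mult_right_mono tail round)
    have "(\<Sum>S\<in>?small. prod ?w S) \<le> (\<Sum>S\<in>Pow P. prod ?w S)"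
      using finite_P by (intro sum_mono2) (auto intro!: prod_nonneg)
    also have "\<dots> \<le> exp ?\<sigma>" unfolding recip_sum_def by (intro sum_subsets_prod_le_exp finite_P) auto
    finally show "(\<Sum>S\<in>?small. prod ?w S) \<le> exp ?\<sigma>" .
    show "real (card ?small) \<le> real y ^ r * exp ?\<sigma>"
      by (rule card_small_subsets_le[OF finite_P bounds_P y_pos])
    show "(\<Sum>S\<in>?large. prod ?w S) \<le> tail"
      unfolding tail_def recip_sum_def by (intro sum_large_subsets_le finite_P assms) auto
  qed
  also have "\<dots> \<le> 2 * (exp ?\<sigma> * tail) + real y ^ r * exp ?\<sigma> * round"
    using mult_right_mono[OF _ tail, of 1 "exp ?\<sigma>"] recip_sum_nonneg[of P]
    by (simp add: mult.commute)
  also have "exp ?\<sigma> * tail = exp ((b + 1) * ?\<sigma>) / b ^ r"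
    by (simp add: tail_def distrib_right exp_add)
  also have "real y ^ r * exp ?\<sigma> * round = real y ^ (2 * r) * exp (2 * ?\<sigma>) / N"
    unfolding mult_2 power_add exp_add by (simp add: round_def mult_ac)
  finally show ?thesis by simp
qed

theorem abs_prob_random_subset_minus_density_le:
  assumes "odd r" "b \<ge> 1"
  shows "\<bar>measure_pmf.prob (random_subset (\<lambda>d. 1 / real d) P) E
      - density_upto N {n. divisors_in P n \<in> E}\<bar>
           \<le> 2 * exp ((b + 1) * recip_sum P) / b ^ r + real y ^ (2 * r) * exp (2 * recip_sum P) / N"
proof -
  let ?M = "random_subset (\<lambda>d. 1 / real d) P"
  let ?M' = "map_pmf (divisors_in P) (pmf_of_set {1..N})"
  have "\<bar>measure_pmf.prob ?M E - measure_pmf.prob ?M' E\<bar> \<le> (\<Sum>S\<in>Pow P. sieve_error P y N r b S)"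
  proof (rule abs_prob_diff_le)
    show "set_pmf ?M \<subseteq> Pow P" using set_random_subset[OF finite_P] by blast
    show "0 \<le> sieve_error P y N r b S" for S
      using assms(2)
      by (auto simp: sieve_error_def
               intro!: add_nonneg_nonneg divide_nonneg_nonneg mult_nonneg_nonneg prod_nonneg)
    fix S assume "S \<in> Pow P"
    with pmf_minus_density_divisors_in_le_sieve_error[of S r b] assms
    show "pmf ?M S - pmf ?M' S \<le> sieve_error P y N r b S"
      using N_pos by (simp add: density_upto_eq_prob pmf_map vimage_def)
  qed (use finite_P in simp)
  also have "measure_pmf.prob ?M' E = density_upto N {n. divisors_in P n \<in> E}"
    using N_pos by (simp add: density_upto_eq_prob vimage_def)
  also note sum_sieve_error_le[OF assms(2)]
  finally show ?thesis .
qed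

end

section \<open>Turan's inequality\<close>

text \<open>Rounding errors enter only through the first moment of the number of divisors in \<open>Q\<close>, since the
  second moment is only bounded from above; this is why \<open>card Q \<le> N\<close> suffices.\<close>

context
  fixes Q :: "nat set" and N :: nat
  assumes finite_Q: "finite Q" and coprime_Q: "pairwise coprime Q" and pos_Q: "\<And>q. q \<in> Q \<Longrightarrow> 0 < q"
begin

lemma sum_card_divisors_in_ge: "N * recip_sum Q - card Q \<le> (\<Sum>n=1..N. real (card (divisors_in Q n)))"
proof -
  have "N * recip_sum Q - card Q = (\<Sum>q\<in>Q. N / q - 1)"
    by (simp add: recip_sum_def sum_subtractf sum_distrib_left)
  also have "\<dots> \<le> (\<Sum>q\<in>Q. real (N div q))" by (intro sum_mono real_div_ge)
  also have "\<dots> = (\<Sum>q\<in>Q. \<Sum>n=1..N. of_bool (q dvd n))"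
    using pos_Q by (intro sum.cong refl sum_dvd_indicator[symmetric])
  also have "\<dots> = (\<Sum>n=1..N. \<Sum>q\<in>Q. of_bool (q dvd n))" by (rule sum.swap)
  finally show ?thesis using finite_Q by (simp add: divisors_in_def sum_of_bool_eq Int_def)
qed

lemma sum_dvd_pair_indicator_le:
  assumes "p \<in> Q" "q \<in> Q"
  shows "(\<Sum>n=1..N. of_bool (p dvd n) * of_bool (q dvd n))
      \<le> (if p = q then N / p else 0) + N * (1 / p * (1 / real q))"
proof (cases "p = q")
  case True
  then have "(\<Sum>n=1..N. of_bool (p dvd n) * of_bool (q dvd n) :: real) = real (N div p)"
    using sum_dvd_indicator[OF pos_Q[OF assms(1)], of N] by (simp flip: of_bool_conj)
  with True show ?thesis
    using of_nat_div_le_of_nat[of N p, where ?'a = real] by (simp add: add_increasing2)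
next
  case False
  then have "coprime p q" using coprime_Q assms by (auto simp: pairwise_def)
  then have "p dvd n \<and> q dvd n \<longleftrightarrow> p * q dvd n" for n
    by (meson divides_mult dvd_mult_left dvd_mult_right)
  then have "(\<Sum>n=1..N. of_bool (p dvd n) * of_bool (q dvd n) :: real)
      = (\<Sum>n=1..N. of_bool (p * q dvd n))"
    by (simp flip: of_bool_conj)
  also have "\<dots> = real (N div (p * q))" using assms pos_Q by (intro sum_dvd_indicator) auto
  also have "\<dots> \<le> N / real (p * q)" by (rule of_nat_div_le_of_nat)
  finally show ?thesis using False by simp
qed

lemma sum_card_divisors_in_squared_le:
  "(\<Sum>n=1..N. (real (card (divisors_in Q n)))\<^sup>2) \<le> N * recip_sum Q + N * (recip_sum Q)\<^sup>2"
proof -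
  have "(\<Sum>n=1..N. (real (card (divisors_in Q n)))\<^sup>2) = (\<Sum>n=1..N. (\<Sum>q\<in>Q. of_bool (q dvd n))\<^sup>2)"
    using finite_Q by (simp add: divisors_in_def sum_of_bool_eq Int_def)
  also have "\<dots> = (\<Sum>n=1..N. \<Sum>p\<in>Q. \<Sum>q\<in>Q. of_bool (p dvd n) * of_bool (q dvd n))"
    unfolding power2_eq_square sum_product ..
  also have "\<dots> = (\<Sum>p\<in>Q. \<Sum>q\<in>Q. \<Sum>n=1..N. of_bool (p dvd n) * of_bool (q dvd n))"
    by (subst sum.swap, intro sum.cong refl sum.swap)
  also have "\<dots> \<le> (\<Sum>p\<in>Q. \<Sum>q\<in>Q. (if p = q then N / p else 0) + N * (1 / p * (1 / q)))"
    by (intro sum_mono sum_dvd_pair_indicator_le)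
  also have "\<dots> = (\<Sum>p\<in>Q. N / p) + (\<Sum>p\<in>Q. \<Sum>q\<in>Q. N * (1 / p * (1 / q)))"
    using finite_Q by (simp add: sum.distrib)
  also have "(\<Sum>p\<in>Q. N / p) = N * recip_sum Q" by (simp add: recip_sum_def sum_distrib_left)
  also have "(\<Sum>p\<in>Q. \<Sum>q\<in>Q. N * (1 / p * (1 / real q))) = N * (recip_sum Q)\<^sup>2"
    by (simp only: recip_sum_def power2_eq_square sum_product flip: sum_distrib_left)
  finally show ?thesis .
qed

theorem density_divisors_in_empty_le:
  assumes "card Q \<le> N" and pos: "recip_sum Q > 0"
  shows "density_upto N {n. divisors_in Q n = {}} \<le> 3 / recip_sum Q"
proof (cases "N = 0")
  case False
  let ?s = "recip_sum Q" and ?om = "\<lambda>n. real (card (divisors_in Q n))"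
  let ?A = "{n. divisors_in Q n = {}} \<inter> {1..N}"
  have "card ?A * ?s\<^sup>2 = (\<Sum>n\<in>?A. (?om n - ?s)\<^sup>2)" by simp
  also have "\<dots> \<le> (\<Sum>n=1..N. (?om n - ?s)\<^sup>2)" by (intro sum_mono2) auto
  also have "\<dots> = (\<Sum>n=1..N. (?om n)\<^sup>2) - 2 * ?s * (\<Sum>n=1..N. ?om n) + N * ?s\<^sup>2"
    by (simp add: power2_diff sum.distrib sum_subtractf sum_distrib_left mult_ac)
  also have "\<dots> \<le> (N * ?s + N * ?s\<^sup>2) - 2 * ?s * (N * ?s - N) + N * ?s\<^sup>2"
  proof (intro add_mono diff_mono mult_left_mono sum_card_divisors_in_squared_le)
    show "N * ?s - N \<le> (\<Sum>n=1..N. ?om n)" using sum_card_divisors_in_ge assms(1) by linarith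
  qed (use pos in auto)
  also have "\<dots> = 3 * N * ?s" by (simp add: algebra_simps power2_eq_square)
  finally have "card ?A * ?s \<le> 3 * N" using pos by (simp add: power2_eq_square flip: mult.assoc)
  then show ?thesis using False pos by (simp add: density_upto_def field_simps)
qed (use pos in \<open>simp add: density_upto_def\<close>)

end

section \<open>Early gaps and long gaps\<close>

definition prime_free :: "nat \<Rightarrow> nat \<Rightarrow> nat set" where
  "prime_free u v = {n. divisors_in (primes_in u v) n = {}}"

lemma density_prime_free_le:
  assumes "2 \<le> u" "u \<le> v" "v \<le> N" "mertens_error 2 < ln (log u v)"
  shows "density_upto N (prime_free u v) \<le> 3 / (ln (log u v) - mertens_error 2)"
proof -
  have recip: "ln (log u v) - mertens_error 2 \<le> prime_recip_sum u v"
    using abs_prime_recip_sum_diff_le[OF assms(1,2)] mertens_error_antimono[of 2 u] assms(1)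
    by linarith
  have "card (primes_in u v) \<le> card {1..v}" by (intro card_mono) (auto simp: primes_in_def)
  then have "card (primes_in u v) \<le> N" using assms(3) by simp
  then have "density_upto N (prime_free u v) \<le> 3 / prime_recip_sum u v"
    unfolding prime_free_def using recip assms(4)
    by (intro density_divisors_in_empty_le pairwise_coprime_primes_in) (auto simp: primes_in_def)
  also have "\<dots> \<le> 3 / (ln (log u v) - mertens_error 2)"
    using recip assms(4) by (intro divide_left_mono) auto
  finally show ?thesis .
qed

definition consecutive_in :: "'a :: linorder set \<Rightarrow> 'a \<Rightarrow> 'a \<Rightarrow> bool" where
  "consecutive_in A a b \<longleftrightarrow> a \<in> A \<and> b \<in> A \<and> a < b \<and> A \<inter> {a<..<b} = {}"

definition long_gap :: "nat \<Rightarrow> nat set" where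
  "long_gap K = {n. \<exists>p q. consecutive_in (prime_factors n) p q \<and> p ^ K < q}"

definition early_gap :: "nat \<Rightarrow> nat \<Rightarrow> nat set" where
  "early_gap m K = {n. \<exists>p\<in>prime_factors n. p \<le> m \<and> (\<forall>q\<in>prime_factors n. p < q \<longrightarrow> p ^ K < q)}"

lemma gap_from_divisors_in_iff:
  assumes "n > 0" "K > 0" "p ^ K \<le> y"
  shows "gap_from K p (divisors_in (primes_in 0 y) n)
           \<longleftrightarrow> p \<in> prime_factors n \<and> (\<forall>q\<in>prime_factors n. p < q \<longrightarrow> p ^ K < q)"
proof -
  have "divisors_in (primes_in 0 y) n = prime_factors n \<inter> {..y}"
    using assms(1) by (auto simp: divisors_in_def primes_in_def in_prime_factors_iff prime_gt_0_nat)
  moreover have "p \<le> y" using le_of_power_le[OF assms(3,2)] .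
  moreover have "q \<le> y \<or> p ^ K < q" for q using assms(3) by linarith
  ultimately show ?thesis unfolding gap_from_iff[OF assms(2)] by blast
qed

lemma early_gap_iff_gap_from:
  assumes "n > 0" "K > 0"
  shows "n \<in> early_gap m K \<longleftrightarrow> (\<exists>p\<le>m. gap_from K p (divisors_in (primes_in 0 (m ^ K)) n))"
  using assms by (auto simp: early_gap_def gap_from_divisors_in_iff power_mono)

lemma early_gap_subset: "early_gap m K \<inter> {1..N} \<subseteq> long_gap K \<union> prime_free m N"
proof
  fix n assume "n \<in> early_gap m K \<inter> {1..N}"
  then obtain p where p: "p \<in> prime_factors n" "p \<le> m" "\<And>q. q \<in> prime_factors n \<Longrightarrow> p < q \<Longrightarrow> p ^ K < q"
    and n: "n \<in> {1..N}" by (auto simp: early_gap_def)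
  let ?above = "{q\<in>prime_factors n. p < q}"
  show "n \<in> long_gap K \<union> prime_free m N"
  proof (cases "?above = {}")
    case True
    then have "n \<in> prime_free m N"
      using p(2) n by (auto simp: prime_free_def divisors_in_def primes_in_def in_prime_factors_iff)
    then show ?thesis ..
  next
    case False
    define q where "q = Min ?above"
    have "q \<in> ?above" unfolding q_def using False by (intro Min_in) auto
    moreover have "q \<le> r" if "r \<in> ?above" for r unfolding q_def using that by (intro Min_le) auto
    ultimately have "consecutive_in (prime_factors n) p q"
      using p(1) by (force simp: consecutive_in_def)
    with p(3)[of q] \<open>q \<in> ?above\<close> have "n \<in> long_gap K" by (auto simp: long_gap_def)
    then show ?thesis ..
  qed
qed

lemma tower_window:
  fixes m B p :: nat
  assumes m: "2 \<le> m" and B: "2 \<le> B" and p: "m < p"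
  obtains i where "p \<le> m ^ (B ^ i)" "m ^ (B ^ Suc i) \<le> p ^ B\<^sup>2"
proof
  have "p < m ^ p" using m by (intro power_gt_expt) auto
  also have "\<dots> \<le> m ^ (B ^ p)"
    using m B power_gt_expt[of B p] by (intro power_increasing) auto
  finally have ex: "p \<le> m ^ (B ^ p)" by simp
  define i where "i = (LEAST i. p \<le> m ^ (B ^ i))"
  show "p \<le> m ^ (B ^ i)" unfolding i_def using ex by (rule LeastI)
  with p have "i \<noteq> 0" by (intro notI) simp
  then obtain j where j: "i = Suc j" by (cases i) auto
  have lower: "m ^ (B ^ j) < p"
    using not_less_Least[of j "\<lambda>i. p \<le> m ^ (B ^ i)"] by (simp add: j[unfolded i_def])
  have "m ^ (B ^ Suc i) = (m ^ (B ^ j)) ^ B\<^sup>2"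
    by (simp add: j power2_eq_square mult_ac flip: power_mult)
  also have "\<dots> \<le> p ^ B\<^sup>2" using lower by (intro power_mono) auto
  finally show "m ^ (B ^ Suc i) \<le> p ^ B\<^sup>2" .
qed

definition gap_windows :: "nat \<Rightarrow> nat \<Rightarrow> nat \<Rightarrow> nat \<Rightarrow> nat set" where
  "gap_windows m B J N = {i. i < J \<and> m ^ (B ^ Suc i) \<le> N}"

text \<open>Since \<open>B\<^sup>2 \<le> K\<close>, a long gap that opens above \<open>m\<close> contains the interval between two
  consecutive points \<open>m ^ (B ^ i)\<close>.\<close>

lemma long_gap_subset:
  assumes m: "2 \<le> m" and B: "2 \<le> B" "B\<^sup>2 \<le> K" and N: "N < m ^ (B ^ J)"
  shows "long_gap K \<inter> {1..N}
           \<subseteq> early_gap m K \<union> (\<Union>i\<in>gap_windows m B J N. prime_free (m ^ (B ^ i)) (m ^ (B ^ Suc i)))"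
proof
  fix n assume "n \<in> long_gap K \<inter> {1..N}"
  then obtain p q where p: "p \<in> prime_factors n" and q: "q \<in> prime_factors n"
    and between: "prime_factors n \<inter> {p<..<q} = {}" and gap: "p ^ K < q" and n: "n \<in> {1..N}"
    by (auto simp: long_gap_def consecutive_in_def)
  have "q \<le> N" using q n dvd_imp_le[of q n] by (auto simp: in_prime_factors_iff)
  show "n \<in> early_gap m K \<union> (\<Union>i\<in>gap_windows m B J N. prime_free (m ^ (B ^ i)) (m ^ (B ^ Suc i)))"
  proof (cases "p \<le> m")
    case True
    have "p ^ K < r" if "r \<in> prime_factors n" "p < r" for r
    proof -
      have "r \<notin> {p<..<q}" using between that(1) by blast
      with gap that(2) show ?thesis by simp
    qed
    with p True have "n \<in> early_gap m K" by (auto simp: early_gap_def)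
    then show ?thesis ..
  next
    case False
    then obtain i where upper: "p \<le> m ^ (B ^ i)" and "m ^ (B ^ Suc i) \<le> p ^ B\<^sup>2"
      using tower_window[OF m B(1), of p] by auto
    note this(2)
    also have "p ^ B\<^sup>2 \<le> p ^ K" using B False by (intro power_increasing) auto
    finally have window: "m ^ (B ^ Suc i) < q" using gap by simp
    with N \<open>q \<le> N\<close> have "m ^ (B ^ Suc i) < m ^ (B ^ J)" by simp
    then have "Suc i < J" using m B(1) by (simp only: power_strict_increasing_iff)
    then have "i \<in> gap_windows m B J N" using window \<open>q \<le> N\<close> by (simp add: gap_windows_def)
    moreover have "n \<in> prime_free (m ^ (B ^ i)) (m ^ (B ^ Suc i))"
    proof -
      have "r \<in> prime_factors n \<inter> {p<..<q}"
        if "r \<in> divisors_in (primes_in (m ^ (B ^ i)) (m ^ (B ^ Suc i))) n" for r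
        using that upper window n by (auto simp: divisors_in_def primes_in_def in_prime_factors_iff)
      with between show ?thesis by (auto simp: prime_free_def)
    qed
    ultimately show ?thesis by blast
  qed
qed

lemma density_gap_windows_le:
  assumes m: "2 \<le> m" and B: "2 \<le> B" and pos: "mertens_error 2 < ln B"
  shows "density_upto N (\<Union>i\<in>gap_windows m B J N. prime_free (m ^ (B ^ i)) (m ^ (B ^ Suc i)))
           \<le> 3 * J / (ln B - mertens_error 2)"
proof -
  have "density_upto N (\<Union>i\<in>gap_windows m B J N. prime_free (m ^ (B ^ i)) (m ^ (B ^ Suc i)))
      \<le> (\<Sum>i\<in>gap_windows m B J N. density_upto N (prime_free (m ^ (B ^ i)) (m ^ (B ^ Suc i))))"
    by (rule density_upto_UN_le) (simp add: gap_windows_def)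
  also have "\<dots> \<le> (\<Sum>i\<in>gap_windows m B J N. 3 / (ln B - mertens_error 2))"
  proof (rule sum_mono)
    fix i assume "i \<in> gap_windows m B J N"
    then have N: "m ^ (B ^ Suc i) \<le> N" by (simp add: gap_windows_def)
    have "m ^ 1 \<le> m ^ (B ^ i)" "m ^ (B ^ i) \<le> m ^ (B ^ Suc i)"
      using m B by (intro power_increasing; simp)+
    moreover have "log (m ^ (B ^ i)) (m ^ (B ^ Suc i)) = B"
    proof -
      have "m ^ (B ^ Suc i) = (m ^ (B ^ i)) ^ B" by (simp add: mult.commute flip: power_mult)
      moreover have "log (real a) (real (a ^ B)) = B" if "1 < a" for a :: nat using that by simp
      moreover have "1 < m ^ (B ^ i)" using m \<open>m ^ 1 \<le> m ^ (B ^ i)\<close> by simp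
      ultimately show ?thesis by presburger
    qed
    ultimately show "density_upto N (prime_free (m ^ (B ^ i)) (m ^ (B ^ Suc i)))
        \<le> 3 / (ln B - mertens_error 2)"
      using density_prime_free_le[of "m ^ (B ^ i)" "m ^ (B ^ Suc i)" N] m N pos by simp
  qed
  also have "\<dots> = card (gap_windows m B J N) * (3 / (ln B - mertens_error 2))" by simp
  also have "\<dots> \<le> J * (3 / (ln B - mertens_error 2))"
  proof (rule mult_right_mono)
    have "card (gap_windows m B J N) \<le> card {..<J}"
      by (intro card_mono) (auto simp: gap_windows_def)
    then show "real (card (gap_windows m B J N)) \<le> J" by simp
  qed (use pos in simp)
  finally show ?thesis by (simp add: mult.commute)
qed

lemma abs_density_long_gap_minus_early_gap_le:
  assumes m: "2 \<le> m" "m \<le> N" and B: "2 \<le> B" "B\<^sup>2 \<le> K" and N: "N < m ^ (B ^ J)"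
    and pos: "mertens_error 2 < ln B" "mertens_error 2 < ln (log m N)"
  shows "\<bar>density_upto N (long_gap K) - density_upto N (early_gap m K)\<bar>
           \<le> 3 * J / (ln B - mertens_error 2) + 3 / (ln (log m N) - mertens_error 2)"
proof -
  let ?windows = "\<Union>i\<in>gap_windows m B J N. prime_free (m ^ (B ^ i)) (m ^ (B ^ Suc i))"
  have "density_upto N (long_gap K) \<le> density_upto N (early_gap m K) + density_upto N ?windows"
    using density_upto_mono[OF long_gap_subset[OF m(1) B N]] density_upto_Un_le
    by (rule order_trans)
  moreover have "density_upto N (early_gap m K)
      \<le> density_upto N (long_gap K) + density_upto N (prime_free m N)"
    using density_upto_mono[OF early_gap_subset] density_upto_Un_le by (rule order_trans)
  moreover have "0 \<le> 3 * J / (ln B - mertens_error 2)" "0 \<le> 3 / (ln (log m N) - mertens_error 2)"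
    using pos by simp_all
  ultimately show ?thesis
    using density_gap_windows_le[OF m(1) B(1) pos(1), of N J]
      density_prime_free_le[OF m order_refl pos(2)]
    by linarith
qed

section \<open>The density of integers with a long gap\<close>

lemma abs_random_primes_prob_minus_density_le:
  fixes y r N :: nat
  assumes y: "2 \<le> y" and r: "odd r" "5 * ln (ln N) \<le> r" and N: "y ^ (4 * r) \<le> N"
  defines "T \<equiv> ln (ln N)"
  shows "\<bar>measure_pmf.prob (random_primes y) E
      - density_upto N {n. divisors_in (primes_in 0 y) n \<in> E}\<bar>
           \<le> 2 * exp (4 * mertens_const - T) + exp (2 * (T + mertens_const)) / sqrt N"
proof -
  let ?\<sigma> = "prime_recip_sum 0 y"
  have "y ^ 1 \<le> y ^ (4 * r)" using y r(1) by (intro power_increasing) (auto elim: oddE)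
  then have "y \<le> N" using N by simp
  then have "ln (ln y) \<le> T" unfolding T_def using y by (intro ln_mono) auto
  then have \<sigma>: "0 \<le> ?\<sigma>" "?\<sigma> \<le> T + mertens_const"
    using abs_prime_recip_sum_0_diff_le[OF y] recip_sum_nonneg by (auto simp: abs_le_iff)
  have "(exp 1 + 1) * ?\<sigma> \<le> 4 * ?\<sigma>" using exp_le \<sigma>(1) by (intro mult_right_mono) auto
  then have "(exp 1 + 1) * ?\<sigma> - r \<le> 4 * mertens_const - T"
    using \<sigma>(2) r(2) unfolding T_def by linarith
  then have "exp ((exp 1 + 1) * ?\<sigma> - r) \<le> exp (4 * mertens_const - T)"
    by (simp only: exp_le_cancel_iff)
  then have truncation: "2 * exp ((exp 1 + 1) * ?\<sigma>) / exp 1 ^ r \<le> 2 * exp (4 * mertens_const - T)"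
    using exp_of_nat_mult[of r "1 :: real"] by (simp only: exp_diff[of _ "real r"] mult_1_right)
  have "(real y ^ (2 * r))\<^sup>2 \<le> real N"
    using N by (simp add: mult.commute flip: power_mult of_nat_power)
  then have "real y ^ (2 * r) \<le> sqrt N" by (rule real_le_rsqrt)
  then have "real y ^ (2 * r) / N \<le> 1 / sqrt N"
    using divide_right_mono[of _ "sqrt N" N] by (simp add: sqrt_divide_self_eq inverse_eq_divide)
  then have "real y ^ (2 * r) / N * exp (2 * ?\<sigma>) \<le> 1 / sqrt N * exp (2 * (T + mertens_const))"
    using \<sigma>(2) by (intro mult_mono) auto
  then have rounding: "real y ^ (2 * r) * exp (2 * ?\<sigma>) / N \<le> exp (2 * (T + mertens_const)) / sqrt N"
    by simp
  have "\<bar>measure_pmf.prob (random_primes y) E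
      - density_upto N {n. divisors_in (primes_in 0 y) n \<in> E}\<bar>
      \<le> 2 * exp ((exp 1 + 1) * ?\<sigma>) / exp 1 ^ r + real y ^ (2 * r) * exp (2 * ?\<sigma>) / N"
    unfolding random_primes_def using y r(1) \<open>y \<le> N\<close>
    by (intro abs_prob_random_subset_minus_density_le pairwise_coprime_primes_in)
       (auto simp: primes_in_def)
  with truncation rounding show ?thesis by linarith
qed

lemma prob_early_gap_eq:
  "measure_pmf.prob (random_primes y) {S. \<exists>p\<le>m. gap_from K p S} = 1 - no_gap_prob y K m"
  using measure_pmf.prob_compl[of "{S. \<exists>p\<le>m. gap_from K p S}" "random_primes y"]
  by (simp add: no_gap_prob_def Compl_eq_Diff_UNIV[symmetric] Collect_neg_eq[symmetric])

text \<open>With \<open>T = ln (ln N)\<close> and \<open>m = gap_cutoff N\<close>, \<open>ln (ln m)\<close> is asymptotic to \<open>T\<close>, so that almost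
  all of the sum over \<open>p\<close> is kept, while \<open>m ^ K\<close> with \<open>K\<close> of order \<open>T\<close> is at most \<open>N\<close> to a power of
  order \<open>1 / T\<^sup>2\<close>, small enough for a sieve that is truncated after about \<open>5 * T\<close> steps.\<close>

definition gap_cutoff :: "nat \<Rightarrow> nat" where
  "gap_cutoff N = nat \<lfloor>exp (ln N / ln (ln N) ^ 3)\<rfloor>"

lemma ln_gap_cutoff_le:
  assumes "gap_cutoff N > 0"
  shows "ln (gap_cutoff N) \<le> ln N / ln (ln N) ^ 3"
proof -
  have "real (gap_cutoff N) \<le> exp (ln N / ln (ln N) ^ 3)" by (simp add: gap_cutoff_def of_nat_nat)
  with assms have "ln (gap_cutoff N) \<le> ln (exp (ln N / ln (ln N) ^ 3))" by (intro ln_mono) auto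
  then show ?thesis by simp
qed

lemma gap_cutoff_at_top: "filterlim gap_cutoff at_top sequentially"
  unfolding gap_cutoff_def by real_asymp

lemma eventually_gap_cutoff_ge_2: "eventually (\<lambda>N. 2 \<le> gap_cutoff N) sequentially"
  using gap_cutoff_at_top by (simp add: filterlim_at_top)

lemma nat_floor_sqrt_bounds:
  fixes k :: nat
  assumes "4 \<le> k"
  defines "b \<equiv> nat \<lfloor>sqrt k\<rfloor>"
  shows "2 \<le> b" "b\<^sup>2 \<le> k" "real k \<le> 4 * (real b)\<^sup>2"
proof -
  have b: "real b \<le> sqrt k" "sqrt k < real b + 1"
    unfolding b_def by (auto simp: of_nat_nat)
  have "sqrt (real 4) \<le> sqrt k" using assms(1) by (intro real_sqrt_le_mono) simp
  then show "2 \<le> b" unfolding b_def by (simp add: le_nat_iff le_floor_iff)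
  have "(real b)\<^sup>2 \<le> (sqrt k)\<^sup>2" using b by (intro power_mono) auto
  then show "b\<^sup>2 \<le> k" by (simp flip: of_nat_power)
  have "(sqrt k)\<^sup>2 \<le> (2 * real b)\<^sup>2" using b \<open>2 \<le> b\<close> by (intro power_mono) auto
  then show "real k \<le> 4 * (real b)\<^sup>2" by (simp add: power_mult_distrib)
qed

context
  fixes K :: "nat \<Rightarrow> nat" and c :: real
  assumes c: "c > 0" and K_asymp: "(\<lambda>N. K N / ln (ln N)) \<longlonglongrightarrow> c"
begin

lemma eventually_bounds_of_ln_ln_asymp:
  "eventually (\<lambda>N. c / 2 * ln (ln N) \<le> K N \<and> K N \<le> 2 * c * ln (ln N)) sequentially"
proof -
  have "eventually (\<lambda>N. K N / ln (ln N) > c / 2) sequentially"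
    "eventually (\<lambda>N. K N / ln (ln N) < 2 * c) sequentially"
    by (rule order_tendstoD[OF K_asymp]; use c in simp)+
  moreover note eventually_ln_ln_pos
  ultimately show ?thesis by eventually_elim (simp add: field_simps)
qed

lemma at_top_of_ln_ln_asymp: "filterlim K at_top sequentially"
proof -
  have "filterlim (\<lambda>N. real (K N)) at_top sequentially"
  proof (rule filterlim_at_top_mono)
    show "filterlim (\<lambda>N. c / 2 * ln (ln (real N))) at_top sequentially" using c by real_asymp
    show "eventually (\<lambda>N. c / 2 * ln (ln N) \<le> K N) sequentially"
      using eventually_bounds_of_ln_ln_asymp by eventually_elim simp
  qed
  then show ?thesis by (simp add: filterlim_sequentially_iff_filterlim_real)
qed

lemma ln_ln_gap_cutoff_div_tendsto: "(\<lambda>N. ln (ln (gap_cutoff N)) / K N) \<longlonglongrightarrow> 1 / c"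
proof -
  have "(\<lambda>N. ln (ln (gap_cutoff N)) / ln (ln N)) \<longlonglongrightarrow> 1" unfolding gap_cutoff_def by real_asymp
  from tendsto_divide[OF this K_asymp]
  have "(\<lambda>N. ln (ln (gap_cutoff N)) / ln (ln N) / (K N / ln (ln N))) \<longlonglongrightarrow> 1 / c" using c by simp
  moreover have "eventually (\<lambda>N. ln (ln (gap_cutoff N)) / ln (ln N) / (K N / ln (ln N))
      = ln (ln (gap_cutoff N)) / K N) sequentially"
    using eventually_ln_ln_pos by eventually_elim simp
  ultimately show ?thesis by (rule Lim_transform_eventually)
qed

lemma eventually_sieve_level:
  "eventually (\<lambda>N. \<exists>r. odd r \<and> 5 * ln (ln N) \<le> real r
      \<and> (gap_cutoff N ^ K N) ^ (4 * r) \<le> N) sequentially"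
proof -
  have "eventually (\<lambda>N::nat.
      4 * (5 * ln (ln N) + 3) * (2 * c * ln (ln N)) * (ln N / ln (ln N) ^ 3) \<le> ln N) sequentially"
    using c by real_asymp
  moreover note eventually_ln_ln_pos
  ultimately show ?thesis
    using eventually_bounds_of_ln_ln_asymp eventually_gap_cutoff_ge_2 eventually_gt_at_top[of 0]
  proof eventually_elim
    case (elim N)
    define T where "T = ln (ln (real N))"
    define r where "r = 2 * nat \<lceil>5 / 2 * T\<rceil> + 1"
    have r: "5 * T \<le> r" "r \<le> 5 * T + 3" using elim(2) unfolding r_def T_def by linarith+
    have ln_m: "0 \<le> ln (gap_cutoff N)" "ln (gap_cutoff N) \<le> ln N / T ^ 3"
      using ln_gap_cutoff_le[of N] elim(4) by (auto simp: T_def)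
    have "ln (real ((gap_cutoff N ^ K N) ^ (4 * r))) = 4 * real r * real (K N) * ln (gap_cutoff N)"
      using elim(4) by (simp add: ln_realpow)
    also have "\<dots> \<le> 4 * (5 * T + 3) * (2 * c * T) * (ln N / T ^ 3)"
      using r ln_m elim(2,3) c by (intro mult_mono) (auto simp: T_def)
    also have "\<dots> \<le> ln N" using elim(1) by (simp add: T_def)
    finally have "(gap_cutoff N ^ K N) ^ (4 * r) \<le> N"
      using elim(4,5) by (subst (asm) ln_le_cancel_iff) (auto simp del: of_nat_power)
    with r show ?case by (intro exI[of _ r]) (simp add: T_def r_def)
  qed
qed

lemma density_early_gap_tendsto:
  "(\<lambda>N. density_upto N (early_gap (gap_cutoff N) (K N))) \<longlonglongrightarrow> 1 - exp (- (1 / c))"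
proof (rule Lim_transform)
  let ?m = gap_cutoff
  let ?prob = "\<lambda>N. measure_pmf.prob (random_primes (?m N ^ K N)) {S. \<exists>p\<le>?m N. gap_from (K N) p S}"
  let ?error = "\<lambda>N. 2 * exp (4 * mertens_const - ln (ln N))
      + exp (2 * (ln (ln N) + mertens_const)) / sqrt N"
  show "?prob \<longlonglongrightarrow> 1 - exp (- (1 / c))"
    unfolding prob_early_gap_eq
    by (intro tendsto_diff tendsto_const no_gap_prob_tendsto at_top_of_ln_ln_asymp gap_cutoff_at_top
          ln_ln_gap_cutoff_div_tendsto) simp
  have K_pos: "eventually (\<lambda>N. K N > 0) sequentially"
    using eventually_gt_at_top at_top_of_ln_ln_asymp by (rule eventually_compose_filterlim)
  show "(\<lambda>N. density_upto N (early_gap (?m N) (K N)) - ?prob N) \<longlonglongrightarrow> 0"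
  proof (rule Lim_null_comparison)
    show "?error \<longlonglongrightarrow> 0" by real_asymp
    show "eventually (\<lambda>N. norm (density_upto N (early_gap (?m N) (K N)) - ?prob N)
        \<le> ?error N) sequentially"
      using eventually_sieve_level eventually_gap_cutoff_ge_2 K_pos
    proof eventually_elim
      case (elim N)
      let ?E = "{S. \<exists>p\<le>?m N. gap_from (K N) p S}" and ?P = "primes_in 0 (?m N ^ K N)"
      obtain r where r: "odd r" "5 * ln (ln N) \<le> real r" "(?m N ^ K N) ^ (4 * r) \<le> N"
        using elim(1) by blast
      have "2 \<le> ?m N ^ K N" using elim(2,3) self_le_power[of "?m N" "K N"] by linarith
      moreover have "density_upto N (early_gap (?m N) (K N))
          = density_upto N {n. divisors_in ?P n \<in> ?E}"
        using elim(3) by (intro antisym density_upto_mono) (auto simp: early_gap_iff_gap_from)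
      ultimately show ?case
        using abs_random_primes_prob_minus_density_le[OF _ r, of ?E]
        by (simp add: abs_minus_commute)
    qed
  qed
qed

text \<open>Eight windows suffice, since \<open>ln N / ln m\<close> is about \<open>(ln (ln N))\<^sup>3\<close>, while \<open>B ^ 8\<close> has order
  \<open>(ln (ln N))\<^sup>4\<close>.\<close>

lemma density_long_gap_minus_early_gap_tendsto:
  "(\<lambda>N. density_upto N (long_gap (K N)) - density_upto N (early_gap (gap_cutoff N) (K N))) \<longlonglongrightarrow> 0"
proof (rule Lim_null_comparison)
  let ?m = gap_cutoff
  define B where "B N = nat \<lfloor>sqrt (K N)\<rfloor>" for N
  have ln_B: "filterlim (\<lambda>N. ln (B N) - mertens_error 2) at_top sequentially"
  proof -
    have "filterlim (\<lambda>k::nat. ln (real (nat \<lfloor>sqrt k\<rfloor>)) - mertens_error 2) at_top sequentially"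
      by real_asymp
    from filterlim_compose[OF this at_top_of_ln_ln_asymp] show ?thesis by (simp add: B_def)
  qed
  have ln_log: "filterlim (\<lambda>N. ln (log (?m N) N) - mertens_error 2) at_top sequentially"
    unfolding gap_cutoff_def log_def by real_asymp
  have "(\<lambda>N. 24 / (ln (B N) - mertens_error 2) + 3 / (ln (log (?m N) N) - mertens_error 2)) \<longlonglongrightarrow> 0 + 0"
    by (intro tendsto_add real_tendsto_divide_at_top[OF tendsto_const] ln_B ln_log)
  then show "(\<lambda>N. 24 / (ln (B N) - mertens_error 2)
      + 3 / (ln (log (?m N) N) - mertens_error 2)) \<longlonglongrightarrow> 0" by simp
  have "eventually (\<lambda>N. 0 < ln (B N) - mertens_error 2) sequentially"
    using eventually_gt_at_top ln_B by (rule eventually_compose_filterlim)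
  moreover have "eventually (\<lambda>N. 0 < ln (log (?m N) N) - mertens_error 2) sequentially"
    using eventually_gt_at_top ln_log by (rule eventually_compose_filterlim)
  moreover have "eventually (\<lambda>N. 4 \<le> K N) sequentially"
    using at_top_of_ln_ln_asymp by (simp add: filterlim_at_top)
  moreover have "eventually (\<lambda>N. ?m N \<le> N) sequentially"
      "eventually (\<lambda>N. ln N < (c / 8 * ln (ln N)) ^ 4 * ln (?m N)) sequentially"
    unfolding gap_cutoff_def using c by real_asymp+
  moreover note eventually_ln_ln_pos
  ultimately show "eventually (\<lambda>N.
      norm (density_upto N (long_gap (K N)) - density_upto N (early_gap (?m N) (K N)))
      \<le> 24 / (ln (B N) - mertens_error 2) + 3 / (ln (log (?m N) N) - mertens_error 2)) sequentially"
    using eventually_gap_cutoff_ge_2 eventually_bounds_of_ln_ln_asymp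
  proof eventually_elim
    case (elim N)
    have B: "2 \<le> B N" "(B N)\<^sup>2 \<le> K N" "real (K N) \<le> 4 * (real (B N))\<^sup>2"
      unfolding B_def using elim by (intro nat_floor_sqrt_bounds; simp)+
    then have "c / 8 * ln (ln N) \<le> (real (B N))\<^sup>2" using elim by simp
    then have "(c / 8 * ln (ln N)) ^ 4 \<le> (real (B N) ^ 2) ^ 4"
      using elim c by (intro power_mono) auto
    then have "(c / 8 * ln (ln N)) ^ 4 * ln (?m N) \<le> real (B N) ^ 8 * ln (?m N)"
      using elim by (intro mult_right_mono) (auto simp flip: power_mult)
    also have "\<dots> = ln (real (?m N ^ (B N ^ 8)))" using elim by (simp add: ln_realpow)
    finally have "ln N < ln (real (?m N ^ (B N ^ 8)))" using elim by linarith
    then have "N < ?m N ^ (B N ^ 8)"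
      using elim by (subst (asm) ln_less_cancel_iff) (auto simp del: of_nat_power)
    with abs_density_long_gap_minus_early_gap_le[of "?m N" N "B N" "K N" 8] B(1,2) elim
    show ?case by simp
  qed
qed

theorem density_long_gap_tendsto: "(\<lambda>N. density_upto N (long_gap (K N))) \<longlonglongrightarrow> 1 - exp (- (1 / c))"
  using density_early_gap_tendsto density_long_gap_minus_early_gap_tendsto by (rule Lim_transform)

end

section \<open>Asymptotic densities\<close>

lemma consecutive_in_iff_nth:
  fixes A :: "'a :: linorder set"
  assumes "finite A"
  defines "xs \<equiv> sorted_list_of_set A"
  shows "consecutive_in A a b \<longleftrightarrow> (\<exists>i. Suc i < card A \<and> a = xs ! i \<and> b = xs ! Suc i)"
proof -
  have len: "length xs = card A" and set: "set xs = A" using assms(1) by (simp_all add: xs_def)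
  have strict: "sorted_wrt (<) xs" by (simp add: xs_def)
  have less_iff: "xs ! i < xs ! j \<longleftrightarrow> i < j" if "i < card A" "j < card A" for i j
    using that strict by (metis len linorder_neqE_nat order.asym order.irrefl sorted_wrt_nth_less)
  have mem: "x \<in> A \<longleftrightarrow> (\<exists>i<card A. x = xs ! i)" for x
    unfolding set[symmetric] in_set_conv_nth len by auto
  have nth: "xs ! i \<in> A" if "i < card A" for i
    using that unfolding mem by blast
  show ?thesis
  proof
    assume ab: "consecutive_in A a b"
    then obtain i j where i: "i < card A" "a = xs ! i" and j: "j < card A" "b = xs ! j"
      by (auto simp: consecutive_in_def mem)
    with ab have "i < j" by (simp add: consecutive_in_def less_iff)
    moreover have "\<not> Suc i < j"
    proof
      assume "Suc i < j"
      then have "Suc i < card A" using j(1) by simp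
      with \<open>Suc i < j\<close> i j have "xs ! Suc i \<in> A \<inter> {a<..<b}" by (simp add: less_iff nth)
      with ab show False by (auto simp: consecutive_in_def)
    qed
    ultimately have "j = Suc i" by simp
    with i j show "\<exists>i. Suc i < card A \<and> a = xs ! i \<and> b = xs ! Suc i" by blast
  next
    assume "\<exists>i. Suc i < card A \<and> a = xs ! i \<and> b = xs ! Suc i"
    then obtain i where i: "Suc i < card A" "a = xs ! i" "b = xs ! Suc i" by blast
    have "x \<notin> {a<..<b}" if "x \<in> A" for x
      using that i mem[of x] by (auto simp: less_iff)
    then show "consecutive_in A a b"
      using i nth by (auto simp: consecutive_in_def less_iff)
  qed
qed

lemma consecutive_prime_factors_iff_nth:
  "consecutive_in (prime_factors n) p q
     \<longleftrightarrow> (\<exists>j\<in>{1..<omega n}. p = nth_prime_factor n j \<and> q = nth_prime_factor n (j + 1))"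
proof -
  have "{1..<omega n} = Suc ` {i. Suc i < omega n}" by (auto simp: image_iff Suc_le_eq gr0_conv_Suc)
  then show ?thesis
    by (simp add: consecutive_in_iff_nth nth_prime_factor_def omega_def)
qed

lemma less_max_log_gap_iff:
  assumes "x \<ge> 0"
  shows "x < max_log_gap n \<longleftrightarrow> (\<exists>p q :: nat. consecutive_in (prime_factors n) p q \<and> x < ln (log p q))"
proof (cases "omega n \<ge> 2")
  case True
  then have "x < max_log_gap n \<longleftrightarrow>
      (\<exists>j\<in>{1..<omega n}. x < ln (log (nth_prime_factor n j) (nth_prime_factor n (j + 1))))"
    unfolding max_log_gap_def log_def by (auto simp: Max_gr_iff)
  then show ?thesis unfolding consecutive_prime_factors_iff_nth by blast
next
  case False
  then have "{1..<omega n} = {}" by auto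
  with False assms show ?thesis
    unfolding consecutive_prime_factors_iff_nth by (simp add: max_log_gap_def)
qed

lemma power_less_iff_less_log:
  assumes "1 < p" "0 < q"
  shows "p ^ K < q \<longleftrightarrow> real K < log (real p) (real q)"
  using assms by (simp add: less_log_iff powr_realpow flip: of_nat_power)

definition log_gap_above :: "real \<Rightarrow> nat set" where
  "log_gap_above c = {n. n > 0 \<and> max_log_gap n > iter_ln 3 n - ln (1 / c)}"

lemma log_gap_above_iff:
  assumes "n > 0" "c > 0" "1 \<le> c * ln (ln n)"
  shows "n \<in> log_gap_above c
      \<longleftrightarrow> (\<exists>p q :: nat. consecutive_in (prime_factors n) p q \<and> c * ln (ln n) < log p q)"
proof -
  have pos: "0 < ln (ln n)" using assms(2,3) zero_less_mult_pos[of c "ln (ln n)"] by linarith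
  then have threshold: "iter_ln 3 n - ln (1 / c) = ln (c * ln (ln n))"
    using assms(2) by (simp add: iter_ln_def numeral_3_eq_3 ln_mult ln_div)
  have "ln (c * ln (ln n)) < ln (log p q) \<longleftrightarrow> c * ln (ln n) < log p q"
    if "consecutive_in (prime_factors n) p q" for p q
  proof (rule ln_less_cancel_iff)
    have "prime p" "p < q" using that by (auto simp: consecutive_in_def in_prime_factors_iff)
    then show "0 < log p q" using prime_gt_1_nat[of p] by simp
  qed (use assms(2) pos in simp)
  moreover have "n \<in> log_gap_above c \<longleftrightarrow> ln (c * ln (ln n)) < max_log_gap n"
    using assms(1) by (simp add: log_gap_above_def threshold)
  ultimately show ?thesis
    using less_max_log_gap_iff[of "ln (c * ln (ln n))" n] assms(3) by auto
qed

lemma log_gap_above_imp_long_gap: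
  assumes "n > 0" "c > 0" "1 \<le> c * ln (ln n)" "K \<le> c * ln (ln n)" "n \<in> log_gap_above c"
  shows "n \<in> long_gap K"
proof -
  obtain p q where pq: "consecutive_in (prime_factors n) p q" "c * ln (ln n) < log p q"
    using assms log_gap_above_iff by blast
  then have "1 < p" "0 < q"
    by (auto simp: consecutive_in_def in_prime_factors_iff prime_gt_Suc_0_nat)
  moreover have "real K < log p q" using pq(2) assms(4) by linarith
  ultimately have "p ^ K < q" using power_less_iff_less_log[of p q K] by blast
  with pq(1) show ?thesis by (auto simp: long_gap_def)
qed

lemma long_gap_imp_log_gap_above:
  assumes "n > 0" "c > 0" "1 \<le> c * ln (ln n)" "c * ln (ln n) \<le> K" "n \<in> long_gap K"
  shows "n \<in> log_gap_above c"
proof -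
  obtain p q where pq: "consecutive_in (prime_factors n) p q" "p ^ K < q"
    using assms(5) by (auto simp: long_gap_def)
  then have "1 < p" "0 < q"
    by (auto simp: consecutive_in_def in_prime_factors_iff prime_gt_Suc_0_nat)
  then have "real K < log p q" using pq(2) power_less_iff_less_log[of p q K] by blast
  then have "c * ln (ln n) < log p q" using assms(4) by linarith
  with pq(1) show ?thesis using assms(1-3) log_gap_above_iff by blast
qed

lemma ln_ln_bounds_of_sqrt_le:
  assumes "sqrt N \<le> n" "n \<le> N" "N > (1::real)"
  shows "ln (ln N) - ln 2 \<le> ln (ln n)" "ln (ln n) \<le> ln (ln N)"
proof -
  have "1 < sqrt N" using assms(3) by simp
  then have "1 < n" using assms(1) by linarith
  have "ln N / 2 = ln (sqrt N)" using assms(3) by (simp add: ln_sqrt)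
  also have "\<dots> \<le> ln n" using assms(1) \<open>1 < sqrt N\<close> by (intro ln_mono) auto
  finally have "ln (ln N / 2) \<le> ln (ln n)" using assms(3) by (intro ln_mono) auto
  then show "ln (ln N) - ln 2 \<le> ln (ln n)" using assms(3) by (simp add: ln_div)
  show "ln (ln n) \<le> ln (ln N)" using assms(2,3) \<open>1 < n\<close> by simp
qed

lemma density_upto_lessThan_le: "density_upto N {n. real n < x} \<le> \<bar>x\<bar> / N"
proof -
  have "card ({n. real n < x} \<inter> {1..N}) \<le> card {1..nat \<lfloor>x\<rfloor>}"
    by (intro card_mono) (auto simp: le_nat_floor)
  then have "real (card ({n. real n < x} \<inter> {1..N})) \<le> \<bar>x\<bar>" by simp linarith
  then show ?thesis unfolding density_upto_def by (rule divide_right_mono) simp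
qed

lemma density_upto_le_add_sqrt:
  assumes "\<And>n. n \<in> {1..N} \<Longrightarrow> sqrt N \<le> n \<Longrightarrow> n \<in> A \<Longrightarrow> n \<in> B"
  shows "density_upto N A \<le> density_upto N B + sqrt N / N"
proof -
  have "density_upto N A \<le> density_upto N (B \<union> {n. real n < sqrt N})"
    using assms by (intro density_upto_mono) (force simp: not_less)
  also have "\<dots> \<le> density_upto N B + density_upto N {n. real n < sqrt N}"
    by (rule density_upto_Un_le)
  finally show ?thesis using density_upto_lessThan_le[of N "sqrt N"] by simp
qed

context
  fixes c :: real and N K :: nat
  assumes c: "c > 0" and N: "N > 1" and large: "1 \<le> c * (ln (ln N) - ln 2)"
begin

lemma mult_ln_ln_bounds:
  assumes "n \<in> {1..N}" "sqrt N \<le> n"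
  shows "c * (ln (ln N) - ln 2) \<le> c * ln (ln n)" "c * ln (ln n) \<le> c * ln (ln N)"
  using ln_ln_bounds_of_sqrt_le[of N n] assms c N by simp_all

lemma density_log_gap_above_le:
  assumes "K \<le> c * (ln (ln N) - ln 2)"
  shows "density_upto N (log_gap_above c) \<le> density_upto N (long_gap K) + sqrt N / N"
proof (rule density_upto_le_add_sqrt)
  fix n assume n: "n \<in> {1..N}" "sqrt N \<le> n" "n \<in> log_gap_above c"
  have "1 \<le> c * ln (ln n)" "K \<le> c * ln (ln n)"
    using mult_ln_ln_bounds[OF n(1,2)] large assms by linarith+
  with n c show "n \<in> long_gap K" by (intro log_gap_above_imp_long_gap[of n c]) auto
qed

lemma density_log_gap_above_ge:
  assumes "c * ln (ln N) \<le> K"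
  shows "density_upto N (long_gap K) - sqrt N / N \<le> density_upto N (log_gap_above c)"
proof -
  have "density_upto N (long_gap K) \<le> density_upto N (log_gap_above c) + sqrt N / N"
  proof (rule density_upto_le_add_sqrt)
    fix n assume n: "n \<in> {1..N}" "sqrt N \<le> n" "n \<in> long_gap K"
    have "1 \<le> c * ln (ln n)" "c * ln (ln n) \<le> K"
      using mult_ln_ln_bounds[OF n(1,2)] large assms by linarith+
    with n c show "n \<in> log_gap_above c" by (intro long_gap_imp_log_gap_above) auto
  qed
  then show ?thesis by simp
qed

end

lemma density_log_gap_above_tendsto:
  assumes c: "c > 0"
  shows "(\<lambda>N. density_upto N (log_gap_above c)) \<longlonglongrightarrow> 1 - exp (- (1 / c))"
proof (rule tendsto_sandwich)
  define K where "K N = nat \<lfloor>c * (ln (ln (real N)) - ln 2)\<rfloor>" for N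
  define K' where "K' N = nat \<lceil>c * ln (ln (real N))\<rceil>" for N
  have K: "(\<lambda>N. K N / ln (ln N)) \<longlonglongrightarrow> c" and K': "(\<lambda>N. K' N / ln (ln N)) \<longlonglongrightarrow> c"
    unfolding K_def K'_def using c by real_asymp+
  have large: "eventually (\<lambda>N::nat. 1 \<le> c * (ln (ln N) - ln 2)) sequentially" using c by real_asymp
  have sqrt: "(\<lambda>N::nat. sqrt N / N) \<longlonglongrightarrow> 0" by real_asymp
  show "eventually (\<lambda>N. density_upto N (long_gap (K' N)) - sqrt N / N
      \<le> density_upto N (log_gap_above c)) sequentially"
    using large eventually_gt_at_top[of 1]
    by eventually_elim (rule density_log_gap_above_ge[OF c], simp_all add: K'_def of_nat_ceiling)
  show "eventually (\<lambda>N. density_upto N (log_gap_above c)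
      \<le> density_upto N (long_gap (K N)) + sqrt N / N) sequentially"
    using large eventually_gt_at_top[of 1]
    by eventually_elim (rule density_log_gap_above_le[OF c], simp_all add: K_def)
  show "(\<lambda>N. density_upto N (long_gap (K' N)) - sqrt N / N) \<longlonglongrightarrow> 1 - exp (- (1 / c))"
    using tendsto_diff[OF density_long_gap_tendsto[OF c K'] sqrt] by simp
  show "(\<lambda>N. density_upto N (long_gap (K N)) + sqrt N / N) \<longlonglongrightarrow> 1 - exp (- (1 / c))"
    using tendsto_add[OF density_long_gap_tendsto[OF c K] sqrt] by simp
qed

definition log_gap_within :: "(nat \<Rightarrow> real) \<Rightarrow> nat set" where
  "log_gap_within \<xi> =
     {n. n > 0 \<and> iter_ln 3 n - \<xi> n \<le> max_log_gap n \<and> max_log_gap n \<le> iter_ln 3 n + \<xi> n}"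

lemma density_log_gap_within_tendsto:
  assumes \<xi>: "filterlim \<xi> at_top sequentially"
  shows "(\<lambda>N. density_upto N (log_gap_within \<xi>)) \<longlonglongrightarrow> 1"
proof (rule order_tendstoI)
  fix a :: real assume "a > 1"
  have "density_upto N (log_gap_within \<xi>) \<le> 1" for N
    using density_upto_eq_prob[of N "log_gap_within \<xi>"]
    by (cases "N = 0") (auto simp: density_upto_def)
  then show "eventually (\<lambda>N. density_upto N (log_gap_within \<xi>) < a) sequentially"
    using \<open>a > 1\<close> by (intro always_eventually allI) (rule order_le_less_trans)
next
  fix a :: real assume "a < 1"
  have "((\<lambda>x::real. exp (- (1 / x)) - exp (- x)) \<longlongrightarrow> 1) at_top" by real_asymp
  then have "eventually (\<lambda>x::real. a < exp (- (1 / x)) - exp (- x)) at_top"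
    using \<open>a < 1\<close> by (rule order_tendstoD)
  then obtain M :: real where M: "a < exp (- (1 / M)) - exp (- M)" "M > 0"
    using eventually_happens'[OF _ eventually_conj[OF _ eventually_gt_at_top[of "0::real"]]]
    by fastforce
  obtain k where k: "\<And>n. n \<ge> k \<Longrightarrow> ln M \<le> \<xi> n"
    using \<xi> unfolding filterlim_at_top eventually_sequentially by blast
  have "(\<lambda>N. density_upto N (log_gap_above (1 / M)) - density_upto N (log_gap_above M)
      - \<bar>real k\<bar> / real N)
      \<longlonglongrightarrow> (1 - exp (- (1 / (1 / M)))) - (1 - exp (- (1 / M))) - 0"
    using M(2) by (intro tendsto_diff density_log_gap_above_tendsto lim_const_over_n) auto
  then have "eventually (\<lambda>N. a < density_upto N (log_gap_above (1 / M))
      - density_upto N (log_gap_above M) - \<bar>real k\<bar> / N) sequentially"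
    using M by (intro order_tendstoD(1)) auto
  then show "eventually (\<lambda>N. a < density_upto N (log_gap_within \<xi>)) sequentially"
  proof eventually_elim
    case (elim N)
    have "n \<in> log_gap_within \<xi> \<union> log_gap_above M \<union> {n. real n < k}"
      if "n \<in> log_gap_above (1 / M)" for n
      using that k[of n] M(2) by (auto simp: log_gap_above_def log_gap_within_def ln_div not_less)
    then have "density_upto N (log_gap_above (1 / M))
        \<le> density_upto N (log_gap_within \<xi> \<union> log_gap_above M \<union> {n. real n < k})"
      by (intro density_upto_mono) blast
    also have "\<dots> \<le> density_upto N (log_gap_within \<xi>) + density_upto N (log_gap_above M)
        + \<bar>real k\<bar> / N"
      by (intro order_trans[OF density_upto_Un_le] add_mono density_upto_Un_le
            density_upto_lessThan_le)
    finally show ?case using elim by linarith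
  qed
qed

lemma has_asymptotic_densityI:
  assumes "(\<lambda>N. density_upto N A) \<longlonglongrightarrow> \<delta>"
  shows "has_asymptotic_density A \<delta>"
proof -
  have floor: "filterlim (\<lambda>x::real. nat \<lfloor>x\<rfloor>) sequentially at_top" by real_asymp
  have ratio: "((\<lambda>x::real. real (nat \<lfloor>x\<rfloor>) / x) \<longlongrightarrow> 1) at_top" by real_asymp
  have "((\<lambda>x::real. density_upto (nat \<lfloor>x\<rfloor>) A * (nat \<lfloor>x\<rfloor> / x)) \<longlongrightarrow> \<delta>) at_top"
    using tendsto_mult[OF filterlim_compose[OF assms floor] ratio] by simp
  moreover have "eventually (\<lambda>x::real. density_upto (nat \<lfloor>x\<rfloor>) A * (nat \<lfloor>x\<rfloor> / x)
      = card {n\<in>A. 1 \<le> n \<and> real n \<le> x} / x) at_top"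
    using eventually_ge_at_top[of 1]
  proof eventually_elim
    case (elim x)
    then have "A \<inter> {1..nat \<lfloor>x\<rfloor>} = {n\<in>A. 1 \<le> n \<and> real n \<le> x}"
      by (auto simp: le_nat_floor le_nat_iff le_floor_iff)
    moreover have "\<lfloor>x\<rfloor> \<noteq> 0" using elim by linarith
    ultimately show ?case using elim by (simp add: density_upto_def)
  qed
  ultimately show ?thesis unfolding has_asymptotic_density_def by (rule Lim_transform_eventually)
qed

theorem theorem1:
  shows "(\<forall>c::real. c > 0 \<longrightarrow>
            has_asymptotic_density
              {n::nat. n > 0 \<and> max_log_gap n > iter_ln 3 (real n) - ln (1 / c)}
              (1 - exp (- (1 / c)))) \<and>
         (\<forall>\<xi> :: nat \<Rightarrow> real. filterlim \<xi> at_top sequentially \<longrightarrow>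
            has_asymptotic_density
              {n::nat. n > 0 \<and> iter_ln 3 (real n) - \<xi> n \<le> max_log_gap n \<and>
                       max_log_gap n \<le> iter_ln 3 (real n) + \<xi> n}
              1)"
  unfolding log_gap_above_def[symmetric] log_gap_within_def[symmetric]
  by (intro conjI allI impI has_asymptotic_densityI density_log_gap_above_tendsto
        density_log_gap_within_tendsto)

end
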